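(* Let $K\subseteq\mathbb{R}^n$ be a convex set, let $X\subseteq K$ be a point-set with $\mathbf{0}\in\mathrm{conv}(X)$, and let $k\in\mathbb{N}$, $k\ge 1$. Then there exist $u_1,\ldots,u_k\in X$ (possibly with repetition) so that $$\Big\|\frac1k\sum_{i=1}^k u_i\Big\|_K\le \frac{\min\{|X|,n+1\}}{k}.$$ Moreover, given $X$ as input, the points $u_1,\ldots,u_k$ can be found in time polynomial in $|X|$, $k$ and $n$.
   Context: For an arbitrary (not necessarily symmetric) convex set $K\subseteq\mathbb{R}^n$ with $\mathbf{0}\in K$, define $\|x\|_K=\inf\{s\ge 0 : x\in sK\}$. *)

theory Defs
  imports "HOL-Analysis.Analysis" "HOL-Library.Function_Algebras"
begin

text \<open>
  The running-time claim concerns one algorithm for all dimensions, so the dimension has to be a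
  value rather than a type. We realise \<open>\<real>\<^sup>n\<close> as the subspace \<open>Rn n\<close> of the real
  vector space of all sequences, with pointwise operations. The library notions
  \<^const>\<open>convex\<close> and \<^const>\<open>hull\<close> are then directly applicable.
\<close>

instantiation "fun" :: (type, real_vector) real_vector
begin

definition scaleR_fun :: "real \<Rightarrow> ('a \<Rightarrow> 'b) \<Rightarrow> 'a \<Rightarrow> 'b"
  where "scaleR_fun a f = (\<lambda>i. a *\<^sub>R f i)"

instance
  by intro_classes (auto simp: scaleR_fun_def fun_eq_iff scaleR_add_left scaleR_add_right)

end

definition Rn :: "nat \<Rightarrow> (nat \<Rightarrow> real) set"
  where "Rn n = {x. \<forall>i\<ge>n. x i = 0}"

text \<open>The infimum is taken in \<^typ>\<open>ereal\<close>, so it is \<open>\<infinity>\<close> if no multiple of \<open>K\<close> contains \<open>x\<close>.\<close>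

definition gauge_norm :: "'a::real_vector set \<Rightarrow> 'a \<Rightarrow> ereal"
  where "gauge_norm K x = Inf (ereal ` {s. 0 \<le> s \<and> x \<in> (\<lambda>y. s *\<^sub>R y) ` K})"

text \<open>\<open>min {|X|, n + 1}\<close>; the case distinction is needed because \<^const>\<open>card\<close> is \<open>0\<close> on infinite sets.\<close>

definition min_card :: "'a set \<Rightarrow> nat \<Rightarrow> nat"
  where "min_card X n = (if finite X then min (card X) (n + 1) else n + 1)"


subsection \<open>Real random access machine\<close>

text \<open>
  Points with arbitrary real coordinates are processed on a real RAM, given as a structured
  imperative language. Natural-number scalars and arrays hold counters and addresses; real numbers
  are stored in two-dimensional arrays. Each arithmetic operation, comparison and memory access
  costs one unit. Programs can test reals only by comparison and contain no real constants other
  than natural numbers. There is no multiplication on addresses and no rounding of reals.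
  Division by zero yields zero.
\<close>

type_synonym name = string

record state =
  nvar :: "name \<Rightarrow> nat"
  narr :: "name \<Rightarrow> nat \<Rightarrow> nat"
  rarr :: "name \<Rightarrow> nat \<Rightarrow> nat \<Rightarrow> real"

datatype nexp =
    NConst nat
  | NVar name
  | NGet name nexp
  | NAdd nexp nexp
  | NSub nexp nexp

datatype rexp =
    ROfNat nexp
  | RGet name nexp nexp
  | RAdd rexp rexp
  | RSub rexp rexp
  | RMul rexp rexp
  | RDiv rexp rexp

datatype bexp =
    NLess nexp nexp
  | RLess rexp rexp
  | BNot bexp
  | BAnd bexp bexp

datatype com =
    Skip
  | NAssign name nexp
  | NStore name nexp nexp
  | RStore name nexp nexp rexp
  | Seq com com
  | Cond bexp com com
  | While bexp com

primrec nval :: "nexp \<Rightarrow> state \<Rightarrow> nat" where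
  "nval (NConst m) s = m"
| "nval (NVar v) s = nvar s v"
| "nval (NGet a e) s = narr s a (nval e s)"
| "nval (NAdd e f) s = nval e s + nval f s"
| "nval (NSub e f) s = nval e s - nval f s"

primrec rval :: "rexp \<Rightarrow> state \<Rightarrow> real" where
  "rval (ROfNat e) s = real (nval e s)"
| "rval (RGet a e f) s = rarr s a (nval e s) (nval f s)"
| "rval (RAdd p q) s = rval p s + rval q s"
| "rval (RSub p q) s = rval p s - rval q s"
| "rval (RMul p q) s = rval p s * rval q s"
| "rval (RDiv p q) s = rval p s / rval q s"

primrec bval :: "bexp \<Rightarrow> state \<Rightarrow> bool" where
  "bval (NLess e f) s \<longleftrightarrow> nval e s < nval f s"
| "bval (RLess p q) s \<longleftrightarrow> rval p s < rval q s"
| "bval (BNot b) s \<longleftrightarrow> \<not> bval b s"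
| "bval (BAnd b c) s \<longleftrightarrow> bval b s \<and> bval c s"

primrec ncost :: "nexp \<Rightarrow> nat" where
  "ncost (NConst m) = 1"
| "ncost (NVar v) = 1"
| "ncost (NGet a e) = 1 + ncost e"
| "ncost (NAdd e f) = 1 + ncost e + ncost f"
| "ncost (NSub e f) = 1 + ncost e + ncost f"

primrec rcost :: "rexp \<Rightarrow> nat" where
  "rcost (ROfNat e) = 1 + ncost e"
| "rcost (RGet a e f) = 1 + ncost e + ncost f"
| "rcost (RAdd p q) = 1 + rcost p + rcost q"
| "rcost (RSub p q) = 1 + rcost p + rcost q"
| "rcost (RMul p q) = 1 + rcost p + rcost q"
| "rcost (RDiv p q) = 1 + rcost p + rcost q"

primrec bcost :: "bexp \<Rightarrow> nat" where
  "bcost (NLess e f) = 1 + ncost e + ncost f"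
| "bcost (RLess p q) = 1 + rcost p + rcost q"
| "bcost (BNot b) = 1 + bcost b"
| "bcost (BAnd b c) = 1 + bcost b + bcost c"

definition nassign :: "name \<Rightarrow> nat \<Rightarrow> state \<Rightarrow> state"
  where "nassign v m s = s\<lparr>nvar := (nvar s)(v := m)\<rparr>"

definition nstore :: "name \<Rightarrow> nat \<Rightarrow> nat \<Rightarrow> state \<Rightarrow> state"
  where "nstore a i m s = s\<lparr>narr := (narr s)(a := (narr s a)(i := m))\<rparr>"

definition rstore :: "name \<Rightarrow> nat \<Rightarrow> nat \<Rightarrow> real \<Rightarrow> state \<Rightarrow> state"
  where "rstore a i j r s =
    s\<lparr>rarr := (rarr s)(a := (rarr s a)(i := (rarr s a i)(j := r)))\<rparr>"

text \<open>\<open>exec c s t s'\<close>: started in state \<open>s\<close>, the program \<open>c\<close> halts in state \<open>s'\<close> after time \<open>t\<close>.\<close>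

inductive exec :: "com \<Rightarrow> state \<Rightarrow> nat \<Rightarrow> state \<Rightarrow> bool" where
  Skip: "exec Skip s 1 s"
| NAssign: "exec (NAssign v e) s (1 + ncost e) (nassign v (nval e s) s)"
| NStore: "exec (NStore a e f) s (1 + ncost e + ncost f) (nstore a (nval e s) (nval f s) s)"
| RStore: "exec (RStore a e f p) s (1 + ncost e + ncost f + rcost p)
             (rstore a (nval e s) (nval f s) (rval p s) s)"
| Seq: "exec c s t s' \<Longrightarrow> exec d s' t' s'' \<Longrightarrow> exec (Seq c d) s (t + t') s''"
| CondTrue: "bval b s \<Longrightarrow> exec c s t s' \<Longrightarrow> exec (Cond b c d) s (1 + bcost b + t) s'"
| CondFalse: "\<not> bval b s \<Longrightarrow> exec d s t s' \<Longrightarrow> exec (Cond b c d) s (1 + bcost b + t) s'"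
| WhileFalse: "\<not> bval b s \<Longrightarrow> exec (While b c) s (1 + bcost b) s"
| WhileTrue: "bval b s \<Longrightarrow> exec c s t s' \<Longrightarrow> exec (While b c) s' t' s'' \<Longrightarrow>
             exec (While b c) s (1 + bcost b + t + t') s''"

inductive_cases SkipE: "exec Skip s t s'"
  and NAssignE: "exec (NAssign v e) s t s'"
  and NStoreE: "exec (NStore a e f) s t s'"
  and RStoreE: "exec (RStore a e f p) s t s'"
  and SeqE: "exec (Seq c d) s t s'"
  and CondE: "exec (Cond b c d) s t s'"
  and WhileE: "exec (While b c) s t s'"

lemma exec_deterministic:
  assumes "exec c s t s'" and "exec c s u s''"
  shows "u = t \<and> s'' = s'"
  using assms
proof (induction arbitrary: u s'' rule: exec.induct)
  case (Skip s)
  then show ?case by (elim SkipE) simp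
next
  case (NAssign v e s)
  then show ?case by (elim NAssignE) simp
next
  case (NStore a e f s)
  then show ?case by (elim NStoreE) simp
next
  case (RStore a e f p s)
  then show ?case by (elim RStoreE) simp
next
  case (Seq c s t s' d t' s2)
  from Seq.prems obtain t1 t2 s1
    where "exec c s t1 s1" "exec d s1 t2 s''" "u = t1 + t2"
    by (elim SeqE) simp
  with Seq.IH show ?case by metis
next
  case (CondTrue b s c t s' d)
  from CondTrue.prems CondTrue.hyps obtain t1
    where "exec c s t1 s''" "u = 1 + bcost b + t1"
    by (elim CondE) simp_all
  with CondTrue.IH show ?case by metis
next
  case (CondFalse b s d t s' c)
  from CondFalse.prems CondFalse.hyps obtain t1
    where "exec d s t1 s''" "u = 1 + bcost b + t1"
    by (elim CondE) simp_all
  with CondFalse.IH show ?case by metis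
next
  case (WhileFalse b s c)
  from WhileFalse.prems show ?case
    by (rule WhileE) (use WhileFalse.hyps in simp_all)
next
  case (WhileTrue b s c t s' t' s2)
  from WhileTrue.prems obtain t1 t2 s1
    where "exec c s t1 s1" "exec (While b c) s1 t2 s''" "u = 1 + bcost b + t1 + t2"
    by (rule WhileE) (use WhileTrue.hyps in simp_all)
  with WhileTrue.IH show ?case by metis
qed

text \<open>
  The input consists of \<open>n\<close>, \<open>k\<close>, the number \<open>N\<close> of points and the points
  \<open>x 0, \<dots>, x (N - 1)\<close>, stored as the rows of the array \<open>X\<close>; all other memory is zero. The output
  points are the first rows of the array \<open>U\<close>, of which only the first \<open>n\<close> entries are read.
\<close>

definition input_state :: "nat \<Rightarrow> nat \<Rightarrow> nat \<Rightarrow> (nat \<Rightarrow> nat \<Rightarrow> real) \<Rightarrow> state" where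
  "input_state n k N x =
    \<lparr>nvar = (\<lambda>v. 0)(''n'' := n, ''k'' := k, ''N'' := N),
     narr = (\<lambda>a i. 0),
     rarr = (\<lambda>a i j. 0)(''X'' := (\<lambda>i j. if i < N \<and> j < n then x i j else 0))\<rparr>"

definition output_point :: "nat \<Rightarrow> state \<Rightarrow> nat \<Rightarrow> nat \<Rightarrow> real"
  where "output_point n s i = (\<lambda>j. if j < n then rarr s ''U'' i j else 0)"

end

theory Submission
  imports Defs
begin

text \<open>
  Let \<open>x 0, \<dots>, x (N - 1)\<close> be the points and \<open>m = min N (n + 1)\<close>. Suppose that
  \<open>0 = \<Sum>\<lambda> i x i\<close> is a convex combination with at most \<open>m\<close> nonzero coefficients, and let
  \<open>c = max 0 (k + 1 - m)\<close>. Taking \<open>x i\<close> with multiplicity \<open>\<mu> i = \<lceil>c \<lambda> i\<rceil>\<close> uses at most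
  \<open>k\<close> points, because rounding up adds less than \<open>m\<close> in total. Padding arbitrarily to \<open>k\<close>
  points only increases the \<open>\<mu> i\<close>. The sum of the points is
  \<open>\<Sum>(\<mu> i - c \<lambda> i) x i\<close>, which has nonnegative coefficients of total mass
  \<open>k - c \<le> m - 1\<close>, so it lies in \<open>(m - 1) conv X\<close>.

  Finding \<open>\<lambda>\<close> exactly is a linear feasibility problem, for which no algorithm is known whose
  number of arithmetic operations is bounded by a polynomial in \<open>n\<close> and \<open>N\<close> alone. But the
  bound \<open>m\<close> leaves one unit of mass unused. It suffices that \<open>\<Sum>\<lambda> i x i = \<Sum>\<delta> i x i\<close> with
  \<open>\<delta> \<ge> 0\<close> of mass at most \<open>1 / k\<close>: the error then contributes at most \<open>c / k \<le> 1\<close>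
  (\<open>gauge_norm_rounded_sum\<close>). Such \<open>\<lambda>\<close> and \<open>\<delta>\<close> are, up to scaling, the positive and
  negative part of a vector in the kernel of the matrix \<open>A\<close> with columns \<open>x i\<close>, provided that
  the mass of the negative part is at most \<open>1 / k\<close> of that of the positive part. This condition
  lives in coefficient space, where distances do not depend on the shape of \<open>conv X\<close>.

  Let \<open>Q\<close> be the orthogonal projector onto \<open>ker A\<close> and \<open>P = 1 - Q\<close>. The kernel contains a
  probability vector, so \<open>0\<close> is in the convex hull of the columns of \<open>P\<close>, which have norm at
  most one. Hence the perceptron rule applies: repeatedly add a column of \<open>P\<close> that has
  nonpositive inner product with the running sum \<open>w\<close>. Then \<open>\<parallel>w\<parallel>\<^sup>2\<close> never exceeds the number of
  steps. If \<open>C\<close> counts how often each column was used in \<open>M\<close> steps, then \<open>Q C = C - w\<close> is in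
  the kernel, its negative part has \<open>1\<close>-norm at most \<open>sqrt (N M)\<close> and its entries sum to at
  least \<open>M - sqrt (N M)\<close>; \<open>M \<ge> N (k + 1)\<^sup>2\<close> steps are enough (\<open>perceptron_bounds\<close>).

  The positive part of \<open>Q C\<close> can have too large a support. As in Caratheodory's theorem, it is
  moved along directions that change neither its image under \<open>A\<close> nor its mass until a coordinate
  vanishes, and that coordinate is then fixed. The space of directions is again represented by its
  orthogonal projector, which each new constraint changes by a matrix of rank one and whose trace
  drops by at most one each time. Once the projector is zero, at least \<open>N\<close> constraints have been
  imposed, so all but \<open>n + 1\<close> coordinates are fixed at zero (\<open>reduction_support\<close>).

  The program consists of loops over ranges that are determined by the input alone, so its
  polynomial running time follows from closure rules, separately from its partial correctness.
  The existence statement for an arbitrary \<open>X\<close> follows by running the program on a finite subset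
  of \<open>X\<close> whose hull contains \<open>0\<close>.
\<close>

section \<open>Orthogonal projectors onto kernels\<close>

text \<open>
  \<open>Q\<close> is the \<open>N \<times> N\<close> matrix of the orthogonal projection onto the common kernel of the
  functionals in \<open>R\<close>: it is symmetric, its columns lie in the kernel, and it fixes the kernel
  pointwise. Matrices and vectors are functions of which only the entries below \<open>N\<close> matter, because
  this is how the program stores them.
\<close>

definition kernel_projector :: "nat \<Rightarrow> (nat \<Rightarrow> real) set \<Rightarrow> (nat \<Rightarrow> nat \<Rightarrow> real) \<Rightarrow> bool" where
  "kernel_projector N R Q \<longleftrightarrow>
     (\<forall>i<N. \<forall>j<N. Q i j = Q j i) \<and>
     (\<forall>r\<in>R. \<forall>j<N. (\<Sum>i<N. r i * Q i j) = 0) \<and>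
     (\<forall>\<alpha>. (\<forall>r\<in>R. (\<Sum>i<N. r i * \<alpha> i) = 0) \<longrightarrow> (\<forall>i<N. (\<Sum>j<N. Q i j * \<alpha> j) = \<alpha> i))"

lemma kernel_projectorD:
  assumes "kernel_projector N R Q"
  shows "\<And>i j. i < N \<Longrightarrow> j < N \<Longrightarrow> Q i j = Q j i"
    and "\<And>r j. r \<in> R \<Longrightarrow> j < N \<Longrightarrow> (\<Sum>i<N. r i * Q i j) = 0"
    and "\<And>\<alpha> i. (\<And>r. r \<in> R \<Longrightarrow> (\<Sum>i<N. r i * \<alpha> i) = 0) \<Longrightarrow> i < N \<Longrightarrow> (\<Sum>j<N. Q i j * \<alpha> j) = \<alpha> i"
  using assms unfolding kernel_projector_def by blast+

lemma kernel_projector_cong: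
  assumes "kernel_projector N R Q" "\<And>i j. i < N \<Longrightarrow> j < N \<Longrightarrow> Q' i j = Q i j"
  shows "kernel_projector N R Q'"
proof -
  note Q = kernel_projectorD[OF assms(1)]
  show ?thesis
    unfolding kernel_projector_def
  proof (intro conjI allI impI ballI)
    show "Q' i j = Q' j i" if "i < N" "j < N" for i j
      using assms(2)[OF that] assms(2)[OF that(2,1)] Q(1)[OF that] by metis
    show "(\<Sum>i<N. r i * Q' i j) = 0" if "r \<in> R" "j < N" for r j
      using Q(2)[OF that] assms(2) that(2) by simp
    show "(\<Sum>j<N. Q' i j * \<alpha> j) = \<alpha> i" if "\<forall>r\<in>R. (\<Sum>i<N. r i * \<alpha> i) = 0" "i < N" for \<alpha> i
      using Q(3)[of \<alpha>, OF _ that(2)] assms(2) that by simp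
  qed
qed

lemma kernel_projector_identity: "kernel_projector N {} (\<lambda>i j. if i = j then 1 else 0)"
  unfolding kernel_projector_def by (auto simp: mult_delta_left)

lemma kernel_projector_idem:
  assumes "kernel_projector N R Q" "i < N" "j < N"
  shows "(\<Sum>l<N. Q i l * Q l j) = Q i j"
  by (rule kernel_projectorD(3)[OF assms(1)]) (simp_all add: kernel_projectorD(2)[OF assms(1)] assms)

lemma kernel_projector_image:
  assumes "kernel_projector N R Q" "r \<in> R"
  shows "(\<Sum>i<N. r i * (\<Sum>j<N. Q i j * a j)) = 0"
proof -
  have "(\<Sum>i<N. r i * (\<Sum>j<N. Q i j * a j)) = (\<Sum>i<N. \<Sum>j<N. r i * Q i j * a j)"
    by (simp add: sum_distrib_left mult.assoc)
  also have "\<dots> = (\<Sum>j<N. \<Sum>i<N. r i * Q i j * a j)" by (rule sum.swap)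
  also have "\<dots> = (\<Sum>j<N. (\<Sum>i<N. r i * Q i j) * a j)" by (simp add: sum_distrib_right)
  also have "\<dots> = 0" using kernel_projectorD(2)[OF assms] by simp
  finally show ?thesis .
qed

lemma kernel_projector_adjoint:
  assumes "kernel_projector N R Q"
  shows "(\<Sum>i<N. (\<Sum>j<N. Q i j * a j) * b i) = (\<Sum>j<N. a j * (\<Sum>i<N. Q j i * b i))"
proof -
  have "(\<Sum>i<N. (\<Sum>j<N. Q i j * a j) * b i) = (\<Sum>i<N. \<Sum>j<N. Q i j * a j * b i)"
    by (simp add: sum_distrib_right)
  also have "\<dots> = (\<Sum>j<N. \<Sum>i<N. Q i j * a j * b i)" by (rule sum.swap)
  also have "\<dots> = (\<Sum>j<N. a j * (\<Sum>i<N. Q j i * b i))"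
    by (auto simp: sum_distrib_left kernel_projectorD(1)[OF assms] intro!: sum.cong)
  finally show ?thesis .
qed

text \<open>
  With \<open>v = Q r\<close>, this is \<open>Q - v v\<^sup>T / (v \<bullet> v)\<close>. If the functional \<open>r\<close> already vanishes on
  the kernel then \<open>v = 0\<close>, and \<open>0 / 0 = 0\<close> leaves \<open>Q\<close> unchanged, so the update has no case
  distinction.
\<close>

definition deflate :: "nat \<Rightarrow> (nat \<Rightarrow> nat \<Rightarrow> real) \<Rightarrow> (nat \<Rightarrow> real) \<Rightarrow> nat \<Rightarrow> nat \<Rightarrow> real" where
  "deflate N Q r i j = Q i j - (\<Sum>l<N. Q i l * r l) * (\<Sum>l<N. Q j l * r l) / (\<Sum>i<N. (\<Sum>l<N. Q i l * r l)\<^sup>2)"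

lemma deflate_cong:
  assumes "\<And>i j. i < N \<Longrightarrow> j < N \<Longrightarrow> Q' i j = Q i j" "\<And>j. j < N \<Longrightarrow> r' j = r j" "i < N" "j < N"
  shows "deflate N Q' r' i j = deflate N Q r i j"
proof -
  have "(\<Sum>l<N. Q' i l * r' l) = (\<Sum>l<N. Q i l * r l)" if "i < N" for i
    using assms(1,2) that by (intro sum.cong) auto
  then show ?thesis using assms unfolding deflate_def by simp
qed

text \<open>
  The part of the kernel that is cut off by the functional \<open>a\<close> is spanned by \<open>v = Q a\<close>, the
  component of \<open>a\<close> inside the kernel. As \<open>Q\<close> is an orthogonal projector, \<open>a \<bullet> v = v \<bullet> v\<close>.
\<close>

lemma kernel_projector_deflate:
  assumes Q: "kernel_projector N R Q"
  shows "kernel_projector N (insert a R) (deflate N Q a)"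
proof -
  define v where "v i = (\<Sum>l<N. Q i l * a l)" for i
  define s where "s = (\<Sum>i<N. (v i)\<^sup>2)"
  have d: "deflate N Q a i j = Q i j - v i * v j / s" for i j
    by (simp add: deflate_def v_def s_def)
  have Qv: "(\<Sum>j<N. Q i j * v j) = v i" if "i < N" for i
    by (rule kernel_projectorD(3)[OF Q _ that]) (use kernel_projector_image[OF Q] in \<open>simp add: v_def\<close>)
  have "s = (\<Sum>i<N. (\<Sum>l<N. Q i l * a l) * v i)" by (simp add: s_def power2_eq_square v_def)
  also have "\<dots> = (\<Sum>j<N. a j * (\<Sum>i<N. Q j i * v i))"
    by (rule kernel_projector_adjoint[OF Q])
  finally have s_eq: "s = (\<Sum>j<N. a j * v j)" using Qv by simp
  have v0: "v i = 0" if "s = 0" "i < N" for i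
    using that sum_nonneg_eq_0_iff[of "{..<N}" "\<lambda>i. (v i)\<^sup>2"] by (simp add: s_def)
  have va: "(\<Sum>i<N. a i * Q i j) = v j" if "j < N" for j
    using that kernel_projectorD(1)[OF Q] by (auto simp: v_def mult.commute intro!: sum.cong)
  have split: "(\<Sum>i<N. r i * (Q i j - v i * v j / s)) = (\<Sum>i<N. r i * Q i j) - (\<Sum>i<N. r i * v i) * v j / s" for r j
    by (simp add: right_diff_distrib sum_subtractf sum_distrib_right sum_divide_distrib mult.assoc)
  show ?thesis
    unfolding kernel_projector_def d
  proof (intro conjI allI impI ballI)
    fix i j assume "i < N" "j < N"
    then show "Q i j - v i * v j / s = Q j i - v j * v i / s"
      using kernel_projectorD(1)[OF Q, of i j] by simp
  next
    fix r j assume r: "r \<in> insert a R" and j: "j < N"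
    show "(\<Sum>i<N. r i * (Q i j - v i * v j / s)) = 0"
    proof (cases "r \<in> R")
      case True
      then have "(\<Sum>i<N. r i * v i) = 0" using kernel_projector_image[OF Q] by (simp add: v_def)
      then show ?thesis using True j kernel_projectorD(2)[OF Q] unfolding split by simp
    next
      case False
      then have "r = a" using r by simp
      then show ?thesis unfolding split using va[OF j] s_eq v0[OF _ j] by (cases "s = 0") simp_all
    qed
  next
    fix \<alpha> i assume al: "\<forall>r\<in>insert a R. (\<Sum>i<N. r i * \<alpha> i) = 0" and i: "i < N"
    have fix\<alpha>: "(\<Sum>j<N. Q l j * \<alpha> j) = \<alpha> l" if "l < N" for l
      using al that by (intro kernel_projectorD(3)[OF Q]) simp_all
    have "(\<Sum>i<N. v i * \<alpha> i) = (\<Sum>j<N. a j * (\<Sum>i<N. Q j i * \<alpha> i))"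
      unfolding v_def by (rule kernel_projector_adjoint[OF Q])
    also have "\<dots> = 0" using fix\<alpha> al by simp
    finally have va0: "(\<Sum>i<N. v i * \<alpha> i) = 0" .
    have "(\<Sum>j<N. (Q i j - v i * v j / s) * \<alpha> j) = (\<Sum>j<N. Q i j * \<alpha> j) - v i * (\<Sum>j<N. v j * \<alpha> j) / s"
      by (simp add: left_diff_distrib sum_subtractf sum_distrib_left sum_divide_distrib mult.assoc)
    then show "(\<Sum>j<N. (Q i j - v i * v j / s) * \<alpha> j) = \<alpha> i" using va0 fix\<alpha>[OF i] by simp
  qed
qed

text \<open>
  The trace of a projector is the dimension of its range. Tracking it through the updates replaces
  every argument about ranks and dimensions.
\<close>

lemma trace_deflate: "(\<Sum>i<N. deflate N Q a i i) \<ge> (\<Sum>i<N. Q i i) - 1"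
proof -
  define s where "s = (\<Sum>i<N. (\<Sum>l<N. Q i l * a l)\<^sup>2)"
  have "(\<Sum>i<N. deflate N Q a i i) = (\<Sum>i<N. Q i i) - s / s"
  proof -
    have "deflate N Q a i i = Q i i - (\<Sum>l<N. Q i l * a l)\<^sup>2 / s" for i
      by (simp add: deflate_def s_def power2_eq_square)
    then show ?thesis by (simp add: sum_subtractf s_def flip: sum_divide_distrib)
  qed
  then show ?thesis by (cases "s = 0") simp_all
qed

text \<open>
  In particular the diagonal is nonnegative, and a vanishing diagonal entry means that the whole
  column vanishes.
\<close>

lemma kernel_projector_diagonal:
  assumes "kernel_projector N R Q" "b < N"
  shows "Q b b = (\<Sum>i<N. (Q i b)\<^sup>2)"
proof -
  have "Q b b = (\<Sum>i<N. Q b i * Q i b)" using kernel_projector_idem[OF assms(1,2,2)] by simp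
  also have "\<dots> = (\<Sum>i<N. (Q i b)\<^sup>2)"
    by (intro sum.cong) (auto simp: power2_eq_square kernel_projectorD(1)[OF assms(1) assms(2)])
  finally show ?thesis .
qed

section \<open>Almost nonnegative kernel vectors by the perceptron rule\<close>

text \<open>
  \<open>C\<close> holds the number of times each column was chosen and \<open>V = Q C\<close>. The running sum of the
  chosen columns of \<open>1 - Q\<close> is \<open>C - V\<close>; its squared norm is at most the number of steps.
\<close>

definition perceptron_inv :: "nat \<Rightarrow> (nat \<Rightarrow> nat \<Rightarrow> real) \<Rightarrow> (nat \<Rightarrow> real) \<Rightarrow> (nat \<Rightarrow> real) \<Rightarrow> bool" where
  "perceptron_inv N Q C V \<longleftrightarrow> (\<forall>i<N. 0 \<le> C i) \<and> (\<forall>i<N. V i = (\<Sum>j<N. Q i j * C j)) \<and>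
     (\<Sum>i<N. (C i - V i)\<^sup>2) \<le> (\<Sum>i<N. C i)"

text \<open>
  The running sum \<open>W = C - V\<close> lies in the range of \<open>1 - Q\<close>, so its inner product with column
  \<open>i\<close> of \<open>1 - Q\<close> is simply \<open>W i\<close>, which is nonpositive. The column itself has squared norm
  \<open>1 - Q i i \<le> 1\<close>.
\<close>

lemma perceptron_step:
  assumes Q: "kernel_projector N R Q" and inv: "perceptron_inv N Q C V"
    and i: "i < N" "C i \<le> V i"
    and C': "\<And>j. j < N \<Longrightarrow> C' j = (if j = i then C i + 1 else C j)"
    and V': "\<And>j. j < N \<Longrightarrow> V' j = V j + Q j i"
  shows "perceptron_inv N Q C' V'" and "(\<Sum>j<N. C' j) = (\<Sum>j<N. C j) + 1"
proof -
  define e :: "nat \<Rightarrow> real" where "e j = (if j = i then 1 else 0)" for j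
  have C'e: "C' j = C j + e j" if "j < N" for j using that C' by (simp add: e_def)
  have ee: "(\<Sum>j<N. f j * e j) = f i" for f :: "nat \<Rightarrow> real"
    using i by (simp add: e_def mult_delta_right)
  have sum_e: "(\<Sum>j<N. e j) = 1" using ee[of "\<lambda>_. 1"] by simp
  show s: "(\<Sum>j<N. C' j) = (\<Sum>j<N. C j) + 1"
    using C'e sum_e by (simp add: sum.distrib)
  have V: "V j = (\<Sum>l<N. Q j l * C l)" if "j < N" for j
    using inv that by (simp add: perceptron_inv_def)
  have QV: "(\<Sum>l<N. Q j l * V l) = V j" if "j < N" for j
    using that V kernel_projector_image[OF Q] by (intro kernel_projectorD(3)[OF Q]) simp_all
  define W where "W j = C j - V j" for j
  have orth: "(\<Sum>j<N. W j * Q j i) = 0"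
  proof -
    have "(\<Sum>j<N. W j * Q j i) = (\<Sum>j<N. Q i j * C j) - (\<Sum>j<N. Q i j * V j)"
      unfolding W_def left_diff_distrib sum_subtractf
      by (intro arg_cong2[where f = minus] sum.cong) (auto simp: kernel_projectorD(1)[OF Q i(1)])
    also have "\<dots> = 0" using QV[OF i(1)] V[OF i(1)] by simp
    finally show ?thesis .
  qed
  have "(\<Sum>j<N. (C' j - V' j)\<^sup>2) = (\<Sum>j<N. (W j + e j - Q j i)\<^sup>2)"
    using C'e V' by (intro sum.cong) (auto simp: W_def algebra_simps)
  also have "\<dots> = (\<Sum>j<N. (W j)\<^sup>2 + 2 * (W j * e j) - 2 * (W j * Q j i) + e j * e j - 2 * (Q j i * e j) + (Q j i)\<^sup>2)"
    by (intro sum.cong) (auto simp: power2_eq_square algebra_simps)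
  also have "\<dots> = (\<Sum>j<N. (W j)\<^sup>2) + 2 * W i + (1 - Q i i)"
    using orth by (simp add: sum.distrib sum_subtractf sum_distrib_left[symmetric] ee
        kernel_projector_diagonal[OF Q i(1), symmetric]) (simp add: e_def)
  also have "\<dots> \<le> (\<Sum>j<N. C j) + 0 + 1"
  proof (intro add_mono)
    show "(\<Sum>j<N. (W j)\<^sup>2) \<le> (\<Sum>j<N. C j)" using inv unfolding W_def perceptron_inv_def by blast
    show "2 * W i \<le> 0" using i by (simp add: W_def)
    have "0 \<le> Q i i" unfolding kernel_projector_diagonal[OF Q i(1)] by (simp add: sum_nonneg)
    then show "1 - Q i i \<le> 1" by simp
  qed
  finally have le: "(\<Sum>j<N. (C' j - V' j)\<^sup>2) \<le> (\<Sum>j<N. C' j)" using s by simp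
  have "V' j = (\<Sum>l<N. Q j l * C' l)" if "j < N" for j
  proof -
    have "(\<Sum>l<N. Q j l * C' l) = (\<Sum>l<N. Q j l * C l) + (\<Sum>l<N. Q j l * e l)"
      using C'e by (simp add: distrib_left sum.distrib)
    then show ?thesis using V[OF that] V'[OF that] ee by simp
  qed
  moreover have "0 \<le> C' j" if "j < N" for j
    using inv that C'e[OF that] by (auto simp: perceptron_inv_def e_def)
  ultimately show "perceptron_inv N Q C' V'" using le by (simp add: perceptron_inv_def)
qed

text \<open>
  \<open>C - V\<close> is orthogonal to the kernel, in particular to the probability vector \<open>l\<close>, so its
  entries cannot all be positive.
\<close>

lemma perceptron_violated_coordinate:
  assumes Q: "kernel_projector N R Q" and inv: "perceptron_inv N Q C V"
    and l: "\<And>i. i < N \<Longrightarrow> 0 \<le> l i" "(\<Sum>i<N. l i) = 1" "\<And>r. r \<in> R \<Longrightarrow> (\<Sum>i<N. r i * l i) = 0"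
  shows "\<exists>i<N. C i \<le> V i"
proof (rule ccontr)
  assume "\<not> ?thesis"
  then have pos: "C i - V i > 0" if "i < N" for i using that by force
  have "(\<Sum>i<N. V i * l i) = (\<Sum>i<N. (\<Sum>j<N. Q i j * C j) * l i)"
    using inv by (simp add: perceptron_inv_def)
  also have "\<dots> = (\<Sum>j<N. C j * (\<Sum>i<N. Q j i * l i))" by (rule kernel_projector_adjoint[OF Q])
  also have "\<dots> = (\<Sum>j<N. C j * l j)" using kernel_projectorD(3)[OF Q, of l] l(3) by simp
  finally have "(\<Sum>i<N. (C i - V i) * l i) = 0" by (simp add: left_diff_distrib sum_subtractf)
  then have "\<forall>i<N. (C i - V i) * l i = 0"
    using pos l(1) by (subst (asm) sum_nonneg_eq_0_iff) (auto intro!: mult_nonneg_nonneg simp: less_imp_le)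
  then have "\<forall>i<N. l i = 0" using pos by force
  then show False using l(2) by simp
qed

text \<open>
  By Cauchy--Schwarz, the \<open>1\<close>-norm \<open>w\<close> of \<open>C - V\<close> satisfies \<open>w\<^sup>2 \<le> N M\<close> after \<open>M\<close> steps, so
  \<open>(k + 1) w \<le> M\<close> once \<open>M \<ge> N (k + 1)\<^sup>2\<close>. As \<open>C \<ge> 0\<close>, the negative part of \<open>V\<close> is
  at most \<open>\<bar>C - V\<bar>\<close> in each coordinate.
\<close>

lemma perceptron_bounds:
  assumes inv: "perceptron_inv N Q C V" and N: "0 < N" and k: "0 < k"
    and many: "real N * (real k + 1)\<^sup>2 \<le> (\<Sum>i<N. C i)"
  shows "real k * (\<Sum>i<N. max 0 (- V i)) \<le> (\<Sum>i<N. max 0 (V i))" and "0 < (\<Sum>i<N. max 0 (V i))"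
proof -
  define M where "M = (\<Sum>i<N. C i)"
  define w where "w = (\<Sum>i<N. \<bar>C i - V i\<bar>)"
  have "0 < real N * (real k + 1)\<^sup>2" using N by simp
  then have M: "0 < M" using many by (simp add: M_def)
  have "w\<^sup>2 \<le> (\<Sum>i<N. (1::real)\<^sup>2) * (\<Sum>i<N. (\<bar>C i - V i\<bar>)\<^sup>2)"
    using Cauchy_Schwarz_ineq_sum[of "\<lambda>_. 1" "\<lambda>i. \<bar>C i - V i\<bar>" "{..<N}"] by (simp add: w_def)
  also have "\<dots> = N * (\<Sum>i<N. (C i - V i)\<^sup>2)" by simp
  also have "\<dots> \<le> N * M"
    using inv unfolding M_def perceptron_inv_def by (intro mult_left_mono) (blast, simp)
  finally have "((real k + 1) * w)\<^sup>2 \<le> (real k + 1)\<^sup>2 * (N * M)"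
    by (simp add: power_mult_distrib mult_left_mono)
  also have "\<dots> = (N * (real k + 1)\<^sup>2) * M" by simp
  also have "\<dots> \<le> M * M" using many M by (intro mult_right_mono) (simp_all add: M_def)
  finally have "((real k + 1) * w)\<^sup>2 \<le> M\<^sup>2" by (simp only: power2_eq_square[of M])
  then have kM: "(real k + 1) * w \<le> M" using M by (auto intro: power2_le_imp_le)
  have pos: "M - w \<le> (\<Sum>i<N. max 0 (V i))"
    unfolding M_def w_def sum_subtractf[symmetric] by (intro sum_mono) auto
  have neg: "(\<Sum>i<N. max 0 (- V i)) \<le> w"
    unfolding w_def using inv by (intro sum_mono) (auto simp: perceptron_inv_def max_def abs_if)
  have w: "0 \<le> w" by (simp add: w_def sum_nonneg)
  have kw: "real k * w \<le> (\<Sum>i<N. max 0 (V i))" using kM pos by (simp add: distrib_right)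
  have "real k * (\<Sum>i<N. max 0 (- V i)) \<le> real k * w" using neg by (intro mult_left_mono) simp_all
  then show "real k * (\<Sum>i<N. max 0 (- V i)) \<le> (\<Sum>i<N. max 0 (V i))" using kw by simp
  show "0 < (\<Sum>i<N. max 0 (V i))"
  proof (cases "w = 0")
    case True
    then show ?thesis using pos M by simp
  next
    case False
    then have "0 < real k * w" using w k by simp
    then show ?thesis using kw by simp
  qed
qed

section \<open>Reducing the support\<close>

definition unit :: "nat \<Rightarrow> nat \<Rightarrow> real" where "unit p i = (if i = p then 1 else 0)"

lemma sum_unit: "p < N \<Longrightarrow> (\<Sum>i<N. unit p i * f i) = (f p :: real)"
  by (simp add: unit_def mult_delta_left)

text \<open>
  State of the support reduction: \<open>L\<close> agrees with the initial vector \<open>l\<close> on the functionals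
  in \<open>R\<close>, the coordinates in \<open>Z\<close> have been fixed at zero, and \<open>Q\<close> projects onto the directions
  that respect all these constraints. The trace condition says that imposing \<open>R\<close> has lowered the
  trace by at most \<open>q\<close>, and each coordinate in \<open>Z\<close> by at most one.
\<close>

definition reduction_inv :: "nat \<Rightarrow> (nat \<Rightarrow> real) set \<Rightarrow> nat \<Rightarrow> (nat \<Rightarrow> real) \<Rightarrow>
    nat set \<Rightarrow> (nat \<Rightarrow> nat \<Rightarrow> real) \<Rightarrow> (nat \<Rightarrow> real) \<Rightarrow> bool" where
  "reduction_inv N R q l Z Q L \<longleftrightarrow> Z \<subseteq> {..<N} \<and> kernel_projector N (R \<union> unit ` Z) Q \<and>
     real N \<le> (\<Sum>i<N. Q i i) + real q + real (card Z) \<and>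
     (\<forall>i<N. 0 \<le> L i) \<and> (\<forall>i\<in>Z. L i = 0) \<and> (\<forall>r\<in>R. (\<Sum>i<N. r i * L i) = (\<Sum>i<N. r i * l i))"

text \<open>
  Moving along column \<open>b\<close> of \<open>Q\<close> respects all constraints. The step length is the largest one that
  keeps \<open>L\<close> nonnegative, as in the ratio test of the simplex method, so coordinate \<open>p\<close> becomes
  zero. It was not fixed before, as the column vanishes at fixed coordinates.
\<close>

lemma reduction_pivot:
  assumes inv: "reduction_inv N R q l Z Q L" and b: "b < N"
    and p: "p < N" "0 < Q p b"
    and min: "\<And>i. i < N \<Longrightarrow> 0 < Q i b \<Longrightarrow> L p / Q p b \<le> L i / Q i b"
    and L': "\<And>i. i < N \<Longrightarrow> L' i = L i - L p / Q p b * Q i b"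
    and Q': "\<And>i j. i < N \<Longrightarrow> j < N \<Longrightarrow> Q' i j = deflate N Q (unit p) i j"
  shows "p \<notin> Z" and "reduction_inv N R q l (insert p Z) Q' L'"
proof -
  note inv' = inv[unfolded reduction_inv_def]
  have Q: "kernel_projector N (R \<union> unit ` Z) Q" and Z: "Z \<subseteq> {..<N}" and L0: "\<And>i. i < N \<Longrightarrow> 0 \<le> L i"
    using inv' by auto
  have Qz: "Q z b = 0" if "z \<in> Z" for z
    using kernel_projectorD(2)[OF Q, of "unit z" b] that b Z sum_unit[of z N "\<lambda>i. Q i b"] by auto
  show p': "p \<notin> Z" using Qz p(2) by force
  have fin: "finite Z" using Z finite_subset by blast
  have t0: "0 \<le> L p / Q p b" using L0[OF p(1)] p(2) by simp
  have "kernel_projector N (insert (unit p) (R \<union> unit ` Z)) Q'"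
    by (rule kernel_projector_cong[OF kernel_projector_deflate[OF Q]]) (rule Q')
  moreover have "real N \<le> (\<Sum>i<N. Q' i i) + real q + real (card (insert p Z))"
  proof -
    have "(\<Sum>i<N. Q' i i) = (\<Sum>i<N. deflate N Q (unit p) i i)" using Q' by simp
    moreover have "real N \<le> (\<Sum>i<N. Q i i) + real q + real (card Z)" using inv' by blast
    ultimately show ?thesis using trace_deflate[of Q N "unit p"] p' fin by simp
  qed
  moreover have "0 \<le> L' i" if i: "i < N" for i
  proof (cases "0 < Q i b")
    case True
    then show ?thesis using min[OF i] L'[OF i] by (simp add: pos_le_divide_eq)
  next
    case False
    then show ?thesis using L'[OF i] L0[OF i] mult_nonneg_nonpos[OF t0, of "Q i b"] by simp
  qed
  moreover have "L' i = 0" if "i \<in> insert p Z" for i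
    using that p Qz L' inv' Z by auto
  moreover have "(\<Sum>i<N. r i * L' i) = (\<Sum>i<N. r i * l i)" if r: "r \<in> R" for r
  proof -
    have "(\<Sum>i<N. r i * L' i) = (\<Sum>i<N. r i * L i) - L p / Q p b * (\<Sum>i<N. r i * Q i b)"
    proof -
      have "(\<Sum>i<N. r i * L' i) = (\<Sum>i<N. r i * L i - L p / Q p b * (r i * Q i b))"
        by (intro sum.cong) (auto simp: L' algebra_simps)
      then show ?thesis by (simp add: sum_subtractf sum_distrib_left)
    qed
    also have "(\<Sum>i<N. r i * Q i b) = 0" using kernel_projectorD(2)[OF Q] r b by simp
    finally show ?thesis using inv' r by simp
  qed
  ultimately show "reduction_inv N R q l (insert p Z) Q' L'"
    using Z p(1) by (simp add: reduction_inv_def)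
qed

text \<open>
  If the diagonal of \<open>Q\<close> is zero then so is the trace, and the count of constraints bounds the
  number of free coordinates by \<open>q\<close>.
\<close>

lemma reduction_support:
  assumes inv: "reduction_inv N R q l Z Q L"
    and fin: "N \<le> card Z \<or> (\<forall>b<N. Q b b = 0)"
  shows "card {i. i < N \<and> L i \<noteq> 0} \<le> min N q"
proof -
  note inv' = inv[unfolded reduction_inv_def]
  have Z: "Z \<subseteq> {..<N}" using inv' by simp
  have "card {i. i < N \<and> L i \<noteq> 0} \<le> card ({..<N} - Z)"
    using inv' by (intro card_mono) auto
  also have "\<dots> = N - card Z" using Z by (simp add: card_Diff_subset finite_subset)
  finally have 1: "card {i. i < N \<and> L i \<noteq> 0} \<le> N - card Z" .
  have "N - card Z \<le> q"
  proof (cases "N \<le> card Z")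
    case False
    then have "(\<Sum>i<N. Q i i) = 0" using fin by simp
    moreover have "real N \<le> (\<Sum>i<N. Q i i) + real q + real (card Z)" using inv' by blast
    ultimately show ?thesis by simp
  qed simp
  then show ?thesis using 1 by simp
qed

section \<open>Rounding to multiplicities\<close>

text \<open>
  Dividing by the total mass \<open>b\<close> turns a nonnegative combination into \<open>b\<close> times a point of the
  convex set.
\<close>

lemma gauge_norm_conic_combination:
  assumes K: "convex K" "\<And>i. i \<in> I \<Longrightarrow> x i \<in> K" and I: "finite I" "I \<noteq> {}"
    and \<beta>: "\<And>i. i \<in> I \<Longrightarrow> 0 \<le> \<beta> i" and m: "sum \<beta> I \<le> m" and k: "0 < k"
  shows "gauge_norm K ((1 / k) *\<^sub>R (\<Sum>i\<in>I. \<beta> i *\<^sub>R x i)) \<le> ereal (m / k)"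
proof -
  define b where "b = sum \<beta> I"
  have b0: "0 \<le> b" using \<beta> by (simp add: b_def sum_nonneg)
  have "\<exists>y\<in>K. (\<Sum>i\<in>I. \<beta> i *\<^sub>R x i) = b *\<^sub>R y"
  proof (cases "b = 0")
    case True
    then have "\<forall>i\<in>I. \<beta> i = 0" using \<beta> I(1) by (simp add: b_def sum_nonneg_eq_0_iff)
    then show ?thesis using True I(2) K(2) by auto
  next
    case False
    have "(\<Sum>i\<in>I. (\<beta> i / b) *\<^sub>R x i) \<in> K"
      using False b0 \<beta> by (intro convex_sum[OF I(1) K(1) _ _ K(2)])
        (simp_all add: b_def flip: sum_divide_distrib)
    moreover have "(\<Sum>i\<in>I. \<beta> i *\<^sub>R x i) = b *\<^sub>R (\<Sum>i\<in>I. (\<beta> i / b) *\<^sub>R x i)"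
      using False by (simp add: scaleR_sum_right)
    ultimately show ?thesis by blast
  qed
  then obtain y where y: "y \<in> K" "(\<Sum>i\<in>I. \<beta> i *\<^sub>R x i) = b *\<^sub>R y" by blast
  have "gauge_norm K ((1 / k) *\<^sub>R (\<Sum>i\<in>I. \<beta> i *\<^sub>R x i)) \<le> ereal (b / k)"
    unfolding gauge_norm_def using y b0 k by (intro Inf_lower imageI) auto
  also have "\<dots> \<le> ereal (m / k)" using m k by (simp add: b_def divide_right_mono)
  finally show ?thesis .
qed

text \<open>
  \<open>L / S\<close> is a convex combination whose value is not \<open>0\<close> but \<open>\<Sum>(D i / S) x i\<close>, with
  \<open>D \<ge> 0\<close> of mass at most \<open>S / k\<close>. Replacing \<open>\<Sum>(c L i / S) x i\<close> by \<open>\<Sum>(c D i / S) x i\<close> in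
  the sum of the chosen points leaves nonnegative coefficients of mass at most
  \<open>(k - c) + c / k \<le> (m - 1) + 1\<close>.
\<close>

lemma gauge_norm_rounded_sum:
  fixes x :: "nat \<Rightarrow> 'a::real_vector"
  assumes N: "0 < N" and k: "0 < k" and m: "0 < m" and c: "c = k + 1 - m"
    and S: "S = (\<Sum>i<N. L i)" "0 < S"
    and D: "\<And>i. i < N \<Longrightarrow> 0 \<le> D i" "real k * (\<Sum>i<N. D i) \<le> S"
    and LD: "(\<Sum>i<N. L i *\<^sub>R x i) = (\<Sum>i<N. D i *\<^sub>R x i)"
    and us: "length us = k" "set us \<subseteq> {..<N}"
    and count: "\<And>i. i < N \<Longrightarrow> real c * L i / S \<le> real (count_list us i)"
    and K: "convex K" "\<And>i. i < N \<Longrightarrow> x i \<in> K"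
  shows "gauge_norm K ((1 / real k) *\<^sub>R (\<Sum>t<k. x (us ! t))) \<le> ereal (real m / real k)"
proof -
  define \<beta> where "\<beta> i = real (count_list us i) - real c * L i / S + real c / S * D i" for i
  have "(\<Sum>t<k. x (us ! t)) = sum_list (map x us)"
    by (simp add: sum_list_sum_nth us(1) atLeast0LessThan)
  also have "\<dots> = (\<Sum>i<N. real (count_list us i) *\<^sub>R x i)"
    using us(2)
  proof (induction us)
    case (Cons u us)
    have "(\<Sum>i<N. real (count_list (u # us) i) *\<^sub>R x i)
        = (\<Sum>i<N. real (count_list us i) *\<^sub>R x i + (if i = u then x i else 0))"
      by (intro sum.cong) (auto simp: scaleR_add_left)
    then show ?case using Cons by (simp add: sum.distrib)
  qed simp
  also have "\<dots> = (\<Sum>i<N. \<beta> i *\<^sub>R x i)"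
  proof -
    have "(\<Sum>i<N. \<beta> i *\<^sub>R x i) = (\<Sum>i<N. real (count_list us i) *\<^sub>R x i)
        - (real c / S) *\<^sub>R (\<Sum>i<N. L i *\<^sub>R x i) + (real c / S) *\<^sub>R (\<Sum>i<N. D i *\<^sub>R x i)"
      by (simp add: \<beta>_def scaleR_add_left scaleR_diff_left sum.distrib sum_subtractf scaleR_sum_right)
    then show ?thesis by (simp add: LD)
  qed
  finally have sum: "(\<Sum>t<k. x (us ! t)) = (\<Sum>i<N. \<beta> i *\<^sub>R x i)" .
  have "sum (count_list us) {..<N} = k"
    using sum_count_set[OF us(2)] us(1) by simp
  then have ck: "(\<Sum>i<N. real (count_list us i)) = real k" by (simp flip: of_nat_sum)
  have "sum \<beta> {..<N} = (\<Sum>i<N. real (count_list us i)) - (\<Sum>i<N. real c * L i / S) + (\<Sum>i<N. real c / S * D i)"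
    by (simp add: \<beta>_def sum.distrib sum_subtractf)
  also have "(\<Sum>i<N. real c * L i / S) = real c * S / S"
    unfolding S(1) by (simp add: sum_distrib_left flip: sum_divide_distrib)
  also have "(\<Sum>i<N. real c / S * D i) = real c / S * (\<Sum>i<N. D i)" by (simp add: sum_distrib_left)
  finally have "sum \<beta> {..<N} = real k - real c + real c / S * (\<Sum>i<N. D i)" using S(2) ck by simp
  moreover have "real c / S * (\<Sum>i<N. D i) \<le> real c / real k"
  proof -
    have "(\<Sum>i<N. D i) / S \<le> 1 / real k" using D(2) S(2) k by (simp add: field_simps)
    then have "real c * ((\<Sum>i<N. D i) / S) \<le> real c * (1 / real k)" by (intro mult_left_mono) simp_all
    then show ?thesis by simp
  qed
  moreover have "real c / real k \<le> 1" using c m k by simp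
  moreover have "real k - real c \<le> real m - 1" using c m by (simp add: of_nat_diff)
  ultimately have "sum \<beta> {..<N} \<le> real m" by linarith
  moreover have "0 \<le> \<beta> i" if "i < N" for i
    using count[OF that] D(1)[OF that] S(2) by (simp add: \<beta>_def)
  ultimately show ?thesis
    unfolding sum using N k by (intro gauge_norm_conic_combination K) auto
qed

text \<open>
  Rounding up adds less than one for each of the at most \<open>m\<close> points with nonzero weight, so the
  length is less than \<open>c + m\<close>, which is \<open>k + 1\<close> unless the subtraction was truncated; in that
  case \<open>c = 0\<close> and nothing is chosen.
\<close>

lemma rounded_counts_length:
  fixes N k m c :: nat and L :: "nat \<Rightarrow> real"
  assumes c: "c = k + 1 - m" and S: "S = (\<Sum>i<N. L i)" "0 < S"
    and L: "\<And>i. i < N \<Longrightarrow> 0 \<le> L i" "card {i. i < N \<and> L i \<noteq> 0} \<le> m"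
    and us: "set us \<subseteq> {..<N}"
    and count: "\<And>i. i < N \<Longrightarrow> count_list us i = 0 \<or>
        0 < real c * L i / S \<and> real (count_list us i) < real c * L i / S + 1"
  shows "length us \<le> k"
proof (cases "c = 0")
  case True
  then have "count_list us i = 0" if "i < N" for i using count[OF that] by simp
  then show ?thesis using us by (metis count_list_0_iff lessThan_iff list.set_intros(1) list.size(3) neq_Nil_conv subset_iff zero_le)
next
  case False
  define A where "A = {i. i < N \<and> L i \<noteq> 0}"
  have fin: "finite A" by (simp add: A_def)
  \<comment> \<open>This makes the bound on the total strict.\<close>
  have "A \<noteq> {}"
  proof
    assume "A = {}"
    then have "S = 0" unfolding S(1) A_def by (intro sum.neutral) auto
    then show False using S(2) by simp
  qed
  have len: "real (length us) = (\<Sum>i<N. real (count_list us i))"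
    using sum_count_set[OF us] by (simp flip: of_nat_sum)
  have "\<dots> = (\<Sum>i\<in>A. real (count_list us i))"
    using count by (intro sum.mono_neutral_right) (force simp: A_def)+
  also have "\<dots> < (\<Sum>i\<in>A. real c * L i / S + 1)"
  proof (rule sum_strict_mono[OF fin \<open>A \<noteq> {}\<close>])
    fix i assume "i \<in> A"
    then have "i < N" by (simp add: A_def)
    have "0 \<le> real c * L i / S" using L(1)[OF \<open>i < N\<close>] S(2) by simp
    then show "real (count_list us i) < real c * L i / S + 1"
      using count[OF \<open>i < N\<close>] by linarith
  qed
  also have "\<dots> = real c * (\<Sum>i\<in>A. L i) / S + real (card A)"
    by (simp add: sum.distrib sum_distrib_left sum_divide_distrib)
  also have "(\<Sum>i\<in>A. L i) = S"
    unfolding S(1) by (intro sum.mono_neutral_left) (auto simp: A_def)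
  finally have "length us < c + card A" using S(2) len by simp
  then show ?thesis using L(2) c False by (simp add: A_def)
qed

section \<open>For loops and polynomial time\<close>

text \<open>
  The counter is reset at the end. A loop that is entered with its counter at zero therefore
  restores all scalar variables, and assertions only need to describe the arrays.
\<close>

definition For :: "name \<Rightarrow> nexp \<Rightarrow> com \<Rightarrow> com" where
  "For v e c = Seq (NAssign v (NConst 0))
     (Seq (While (NLess (NVar v) e) (Seq c (NAssign v (NAdd (NVar v) (NConst 1)))))
       (NAssign v (NConst 0)))"

primrec assigned :: "com \<Rightarrow> name set" where
  "assigned Skip = {}"
| "assigned (NAssign v e) = {v}"
| "assigned (NStore a e f) = {}"
| "assigned (RStore a e f p) = {}"
| "assigned (Seq c d) = assigned c \<union> assigned d"
| "assigned (Cond b c d) = assigned c \<union> assigned d"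
| "assigned (While b c) = assigned c"

lemma assigned_For: "assigned (For v e c) = insert v (assigned c)"
  by (auto simp: For_def)

lemma exec_unassigned:
  "exec c s t s' \<Longrightarrow> v \<notin> assigned c \<Longrightarrow> nvar s' v = nvar s v"
  by (induction rule: exec.induct) (auto simp: nassign_def nstore_def rstore_def)

text \<open>The summand \<open>1\<close> makes powers of the size monotone in the exponent.\<close>

definition input_size :: "state \<Rightarrow> nat" where
  "input_size s = 1 + nvar s ''n'' + nvar s ''k'' + nvar s ''N''"

definition inputs :: "name set" where "inputs = {''n'', ''k'', ''N''}"

text \<open>
  Programs keep the input variables, so that the bound can be stated in terms of the initial state
  and still applies to every later part of a composite program.
\<close>

definition polytime :: "com \<Rightarrow> bool" where
  "polytime c \<longleftrightarrow> assigned c \<inter> inputs = {} \<and>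
     (\<exists>a d. \<forall>s. \<exists>t s'. exec c s t s' \<and> t \<le> a * input_size s ^ d)"

lemma input_size_exec:
  assumes "assigned c \<inter> inputs = {}" "exec c s t s'"
  shows "input_size s' = input_size s"
  using exec_unassigned[OF assms(2)] assms(1) by (auto simp: input_size_def inputs_def)

lemma polytimeI_const:
  assumes "assigned c \<inter> inputs = {}" "\<And>s. \<exists>s'. exec c s a s'"
  shows "polytime c"
  proof -
  have "\<exists>t s'. exec c s t s' \<and> t \<le> a * input_size s ^ 0" for s
    using assms(2)[of s] by auto
  then show ?thesis unfolding polytime_def using assms(1) by blast
qed

lemma polytime_Skip: "polytime Skip"
  by (rule polytimeI_const) (auto intro: exec.intros)

lemma polytime_NStore: "polytime (NStore a e f)"
  by (rule polytimeI_const) (auto intro: exec.intros)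

lemma polytime_RStore: "polytime (RStore a e f p)"
  by (rule polytimeI_const) (auto intro: exec.intros)

lemma poly_bound_mono:
  assumes "a \<le> a'" "d \<le> d'" shows "a * input_size s ^ d \<le> a' * input_size s ^ d'"
  using assms by (intro mult_mono power_increasing) (auto simp: input_size_def)

lemma polytime_common_bound:
  assumes "polytime c" "polytime d"
  obtains a e where "\<And>s. \<exists>t s'. exec c s t s' \<and> t \<le> a * input_size s ^ e"
    and "\<And>s. \<exists>t s'. exec d s t s' \<and> t \<le> a * input_size s ^ e"
proof -
  from assms obtain a1 e1 a2 e2
    where 1: "\<And>s. \<exists>t s'. exec c s t s' \<and> t \<le> a1 * input_size s ^ e1"
      and 2: "\<And>s. \<exists>t s'. exec d s t s' \<and> t \<le> a2 * input_size s ^ e2"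
    unfolding polytime_def by metis
  show ?thesis
  proof (rule that[of "max a1 a2" "max e1 e2"])
    fix s
    show "\<exists>t s'. exec c s t s' \<and> t \<le> max a1 a2 * input_size s ^ max e1 e2"
      using 1[of s] poly_bound_mono[of a1 "max a1 a2" e1 "max e1 e2" s] by (meson le_trans max.cobounded1)
    show "\<exists>t s'. exec d s t s' \<and> t \<le> max a1 a2 * input_size s ^ max e1 e2"
      using 2[of s] poly_bound_mono[of a2 "max a1 a2" e2 "max e1 e2" s] by (meson le_trans max.cobounded2)
  qed
qed

lemma polytime_Seq:
  assumes c: "polytime c" and d: "polytime d"
  shows "polytime (Seq c d)"
proof -
  obtain a e where 1: "\<And>s. \<exists>t s'. exec c s t s' \<and> t \<le> a * input_size s ^ e"
    and 2: "\<And>s. \<exists>t s'. exec d s t s' \<and> t \<le> a * input_size s ^ e"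
    using polytime_common_bound[OF c d] by blast
  have "\<exists>t s'. exec (Seq c d) s t s' \<and> t \<le> 2 * a * input_size s ^ e" for s
  proof -
    obtain t1 s1 where s1: "exec c s t1 s1" "t1 \<le> a * input_size s ^ e" using 1 by blast
    obtain t2 s2 where s2: "exec d s1 t2 s2" "t2 \<le> a * input_size s1 ^ e" using 2 by blast
    have "input_size s1 = input_size s" using c s1 by (auto simp: polytime_def intro: input_size_exec)
    then show ?thesis using exec.Seq[OF s1(1) s2(1)] s1(2) s2(2)
      by (intro exI[of _ "t1 + t2"] exI[of _ s2]) simp
  qed
  then show ?thesis using c d unfolding polytime_def by (auto simp: Int_Un_distrib2)
qed

lemma polytime_Cond:
  assumes c: "polytime c" and d: "polytime d"
  shows "polytime (Cond b c d)"
proof -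
  obtain a e where 1: "\<And>s. \<exists>t s'. exec c s t s' \<and> t \<le> a * input_size s ^ e"
    and 2: "\<And>s. \<exists>t s'. exec d s t s' \<and> t \<le> a * input_size s ^ e"
    using polytime_common_bound[OF c d] by blast
  have "\<exists>t s'. exec (Cond b c d) s t s' \<and> t \<le> (1 + bcost b + a) * input_size s ^ e" for s
  proof -
    obtain t s' where t: "exec (Cond b c d) s (1 + bcost b + t) s'" "t \<le> a * input_size s ^ e"
      using 1[of s] 2[of s] by (meson exec.CondTrue exec.CondFalse)
    moreover have "1 \<le> input_size s ^ e" by (simp add: input_size_def)
    then have "(1 + bcost b) * 1 \<le> (1 + bcost b) * input_size s ^ e" by (rule mult_le_mono2)
    ultimately have "1 + bcost b + t \<le> (1 + bcost b) * input_size s ^ e + a * input_size s ^ e"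
      by simp
    then show ?thesis using t(1) by (metis add_mult_distrib)
  qed
  moreover have "assigned (Cond b c d) \<inter> inputs = {}"
    using c d unfolding polytime_def by auto
  ultimately show ?thesis unfolding polytime_def by blast
qed

text \<open>
  The upper limit \<open>e\<close> of the loop may change during the loop; only its bound by the input size
  matters, which is preserved.
\<close>

lemma While_terminates:
  assumes c: "assigned c \<inter> inputs = {}" "v \<notin> assigned c" "v \<notin> inputs"
    and body: "\<And>s. input_size s = B \<Longrightarrow> \<exists>t s'. exec c s t s' \<and> t \<le> T"
    and e: "\<And>s. nval e s \<le> input_size s"
  shows "input_size s = B \<Longrightarrow> \<exists>t s'. exec (While (NLess (NVar v) e) (Seq c (NAssign v (NAdd (NVar v) (NConst 1))))) s t s' \<and>
           t \<le> (B - nvar s v + 1) * (T + 8 + ncost e)"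
proof (induction "B - nvar s v" arbitrary: s rule: less_induct)
  case less
  let ?b = "NLess (NVar v) e" and ?a = "NAssign v (NAdd (NVar v) (NConst 1))"
  show ?case
  proof (cases "bval ?b s")
    case False
    show ?thesis
      by (rule exI, rule exI, rule conjI, rule exec.WhileFalse[OF False]) simp
  next
    case True
    obtain t1 s1 where s1: "exec c s t1 s1" "t1 \<le> T" using body less.prems by blast
    define s2 where "s2 = nassign v (nval (NAdd (NVar v) (NConst 1)) s1) s1"
    have a: "exec ?a s1 4 s2"
      using exec.NAssign[of v "NAdd (NVar v) (NConst 1)" s1] by (simp add: s2_def numeral_eq_Suc)
    have sv: "nvar s2 v = nvar s v + 1"
      using exec_unassigned[OF s1(1) c(2)] by (simp add: s2_def nassign_def)
    have B: "input_size s2 = B"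
      using input_size_exec[OF c(1) s1(1)] c(3) less.prems
      by (auto simp: s2_def nassign_def input_size_def inputs_def)
    have lt: "nvar s v < B" using True e[of s] less.prems by simp
    obtain t3 s3 where s3: "exec (While ?b (Seq c ?a)) s2 t3 s3"
      "t3 \<le> (B - nvar s2 v + 1) * (T + 8 + ncost e)"
      using less.hyps[of s2] B sv lt by (metis Suc_eq_plus1 diff_less_mono2 lessI)
    have "B - nvar s v + 1 = Suc (B - nvar s2 v + 1)" using lt sv by simp
    moreover have "1 + bcost ?b + (t1 + 4) \<le> T + 8 + ncost e" using s1(2) by simp
    ultimately have "1 + bcost ?b + (t1 + 4) + t3 \<le> (B - nvar s v + 1) * (T + 8 + ncost e)"
      using s3(2) by simp
    then show ?thesis using exec.WhileTrue[OF True exec.Seq[OF s1(1) a] s3(1)] by blast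
  qed
qed

lemma polytime_For:
  assumes c: "polytime c" and v: "v \<notin> assigned c" "v \<notin> inputs"
    and e: "\<And>s. nval e s \<le> input_size s"
  shows "polytime (For v e c)"
proof -
  obtain a d where ad: "\<And>s. \<exists>t s'. exec c s t s' \<and> t \<le> a * input_size s ^ d"
    and ac: "assigned c \<inter> inputs = {}"
    using c unfolding polytime_def by blast
  have "\<exists>t s'. exec (For v e c) s t s' \<and> t \<le> 2 * (a + 12 + ncost e) * input_size s ^ Suc d" for s
  proof -
    define B where "B = input_size s"
    define s0 where "s0 = nassign v 0 s"
    have B1: "1 \<le> B" by (simp add: B_def input_size_def)
    have s0: "exec (NAssign v (NConst 0)) s 2 s0"
      using exec.NAssign[of v "NConst 0" s] by (simp add: s0_def numeral_eq_Suc)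
    have B: "input_size s0 = B" using v(2) by (auto simp: s0_def nassign_def input_size_def inputs_def B_def)
    obtain t1 s1 where s1: "exec (While (NLess (NVar v) e) (Seq c (NAssign v (NAdd (NVar v) (NConst 1))))) s0 t1 s1"
      "t1 \<le> (B - nvar s0 v + 1) * (a * B ^ d + 8 + ncost e)"
      using While_terminates[OF ac v, of B "a * B ^ d" e, OF _ e B] ad by blast
    have s2: "exec (NAssign v (NConst 0)) s1 2 (nassign v 0 s1)"
      using exec.NAssign[of v "NConst 0" s1] by (simp add: numeral_eq_Suc)
    have "2 + (t1 + 2) \<le> (B + 1) * (a * B ^ d + 8 + ncost e) + 4"
      using s1(2) by (simp add: s0_def nassign_def)
    also have "\<dots> \<le> (B + 1) * (a * B ^ d + 12 + ncost e)" by (simp add: algebra_simps)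
    also have "\<dots> \<le> (2 * B) * ((a + 12 + ncost e) * B ^ d)"
    proof (rule mult_mono)
      have "12 + ncost e \<le> (12 + ncost e) * B ^ d" using B1 by simp
      then show "a * B ^ d + 12 + ncost e \<le> (a + 12 + ncost e) * B ^ d"
        by (simp add: add_mult_distrib)
    qed (use B1 in simp_all)
    also have "\<dots> = 2 * (a + 12 + ncost e) * B ^ Suc d" by simp
    finally show ?thesis
      using exec.Seq[OF s0 exec.Seq[OF s1(1) s2]] unfolding For_def B_def by blast
  qed
  moreover have "assigned (For v e c) \<inter> inputs = {}" using ac v by (auto simp: assigned_For)
  ultimately show ?thesis unfolding polytime_def by blast
qed

section \<open>Partial correctness\<close>

text \<open>
  Weakest liberal precondition of a program that restores the scalar variables \<open>E\<close>. Assertions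
  speak about the arrays \<open>h\<close> of numbers and \<open>g\<close> of reals only, so they are not affected by loop
  counters. That a run exists at all is left to \<open>polytime\<close>.
\<close>

definition wlp :: "(name \<Rightarrow> nat) \<Rightarrow> com \<Rightarrow>
    ((name \<Rightarrow> nat \<Rightarrow> nat) \<Rightarrow> (name \<Rightarrow> nat \<Rightarrow> nat \<Rightarrow> real) \<Rightarrow> bool) \<Rightarrow>
    (name \<Rightarrow> nat \<Rightarrow> nat) \<Rightarrow> (name \<Rightarrow> nat \<Rightarrow> nat \<Rightarrow> real) \<Rightarrow> bool" where
  "wlp E c P h g \<longleftrightarrow> (\<forall>t s'. exec c \<lparr>nvar = E, narr = h, rarr = g\<rparr> t s' \<longrightarrow>
     nvar s' = E \<and> P (narr s') (rarr s'))"

lemma wlp_Skip: "P h g \<Longrightarrow> wlp E Skip P h g"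
  by (auto simp: wlp_def elim: SkipE)

lemma wlp_NStore:
  "P (h(a := (h a)(nval e \<lparr>nvar = E, narr = h, rarr = g\<rparr> := nval f \<lparr>nvar = E, narr = h, rarr = g\<rparr>))) g \<Longrightarrow>
   wlp E (NStore a e f) P h g"
  by (auto simp: wlp_def nstore_def elim: NStoreE)

lemma wlp_RStore:
  "P h (g(a := (g a)(nval e \<lparr>nvar = E, narr = h, rarr = g\<rparr> :=
     (g a (nval e \<lparr>nvar = E, narr = h, rarr = g\<rparr>))(nval f \<lparr>nvar = E, narr = h, rarr = g\<rparr> :=
        rval p \<lparr>nvar = E, narr = h, rarr = g\<rparr>)))) \<Longrightarrow>
   wlp E (RStore a e f p) P h g"
  by (auto simp: wlp_def rstore_def elim: RStoreE)

lemma wlp_Seq: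
  assumes "wlp E c (wlp E d P) h g" shows "wlp E (Seq c d) P h g"
  unfolding wlp_def
proof (intro allI impI)
  fix t s'' assume "exec (Seq c d) \<lparr>nvar = E, narr = h, rarr = g\<rparr> t s''"
  then obtain t1 t2 s' where s': "exec c \<lparr>nvar = E, narr = h, rarr = g\<rparr> t1 s'" and s'': "exec d s' t2 s''"
    by (auto elim: SeqE)
  have 1: "nvar s' = E" "wlp E d P (narr s') (rarr s')"
    using assms s' unfolding wlp_def by blast+
  then have "s' = \<lparr>nvar = E, narr = narr s', rarr = rarr s'\<rparr>" by simp
  then show "nvar s'' = E \<and> P (narr s'') (rarr s'')"
    using 1(2) s'' unfolding wlp_def by metis
qed

lemma wlp_Cond:
  assumes "bval b \<lparr>nvar = E, narr = h, rarr = g\<rparr> \<Longrightarrow> wlp E c P h g"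
    and "\<not> bval b \<lparr>nvar = E, narr = h, rarr = g\<rparr> \<Longrightarrow> wlp E d P h g"
  shows "wlp E (Cond b c d) P h g"
  using assms unfolding wlp_def by (blast elim: CondE)

lemma wlp_mono:
  assumes "wlp E c P h g" "\<And>h' g'. P h' g' \<Longrightarrow> P' h' g'" shows "wlp E c P' h g"
  using assms unfolding wlp_def by blast

lemma wlp_Seq_via:
  assumes "wlp E c A h g" "\<And>h' g'. A h' g' \<Longrightarrow> wlp E d P h' g'" shows "wlp E (Seq c d) P h g"
  by (rule wlp_Seq) (rule wlp_mono[OF assms])

lemma wlp_While_counter:
  assumes e: "\<And>i h g. nval e \<lparr>nvar = E(v := i), narr = h, rarr = g\<rparr> = m"
    and step: "\<And>i h g. i < m \<Longrightarrow> I i h g \<Longrightarrow> wlp (E(v := i)) c (I (Suc i)) h g"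
    and ex: "exec w s t s'" and w: "w = While (NLess (NVar v) e) (Seq c (NAssign v (NAdd (NVar v) (NConst 1))))"
  shows "nvar s = E(v := i) \<Longrightarrow> i \<le> m \<Longrightarrow> I i (narr s) (rarr s) \<Longrightarrow>
         nvar s' = E(v := m) \<and> I m (narr s') (rarr s')"
  using ex w
proof (induction w s t s' arbitrary: i rule: exec.induct)
  case (WhileFalse b s c')
  have s: "s = \<lparr>nvar = E(v := i), narr = narr s, rarr = rarr s\<rparr>" by (simp flip: WhileFalse.prems(1))
  have "nval e s = m" by (subst s) (rule e)
  then show ?case using WhileFalse by auto
next
  case (WhileTrue b s c' t s1 t' s2)
  have s: "s = \<lparr>nvar = E(v := i), narr = narr s, rarr = rarr s\<rparr>" by (simp flip: WhileTrue.prems(1))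
  have "nval e s = m" by (subst s) (rule e)
  then have i: "i < m" using WhileTrue by auto
  obtain t1 t2 s0 where s0: "exec c s t1 s0" "exec (NAssign v (NAdd (NVar v) (NConst 1))) s0 t2 s1"
    using WhileTrue.hyps(2) WhileTrue.prems(4) by (auto elim: SeqE)
  have 0: "nvar s0 = E(v := i) \<and> I (Suc i) (narr s0) (rarr s0)"
    using step[OF i WhileTrue.prems(3)] s0(1) s unfolding wlp_def by metis
  have s1: "s1 = nassign v (Suc i) s0" using s0(2) 0 by (auto elim: NAssignE)
  show ?case using WhileTrue.IH(2)[of "Suc i"] WhileTrue.prems(4) 0 i by (simp add: s1 nassign_def)
qed auto

lemma wlp_For:
  assumes v: "E v = 0" and e: "\<And>i h g. nval e \<lparr>nvar = E(v := i), narr = h, rarr = g\<rparr> = m"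
    and init: "I 0 h g"
    and step: "\<And>i h g. i < m \<Longrightarrow> I i h g \<Longrightarrow> wlp (E(v := i)) c (I (Suc i)) h g"
    and post: "\<And>h g. I m h g \<Longrightarrow> P h g"
  shows "wlp E (For v e c) P h g"
  unfolding wlp_def
proof (intro allI impI)
  fix t s' assume "exec (For v e c) \<lparr>nvar = E, narr = h, rarr = g\<rparr> t s'"
  then obtain s0 s1 t0 t1 t2 where 0: "exec (NAssign v (NConst 0)) \<lparr>nvar = E, narr = h, rarr = g\<rparr> t0 s0"
    and 1: "exec (While (NLess (NVar v) e) (Seq c (NAssign v (NAdd (NVar v) (NConst 1))))) s0 t1 s1"
    and 2: "exec (NAssign v (NConst 0)) s1 t2 s'"
    unfolding For_def by (auto elim!: SeqE)
  have s0: "s0 = nassign v 0 \<lparr>nvar = E, narr = h, rarr = g\<rparr>" using 0 by (auto elim: NAssignE)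
  have "nvar s1 = E(v := m) \<and> I m (narr s1) (rarr s1)"
    using init by (intro wlp_While_counter[OF e step 1 refl, of 0]) (auto simp: s0 nassign_def)
  moreover have "s' = nassign v 0 s1" using 2 by (auto elim: NAssignE)
  ultimately show "nvar s' = E \<and> P (narr s') (rarr s')"
    using v post by (auto simp: nassign_def fun_upd_idem)
qed

text \<open>Frame condition: only the arrays named in \<open>A\<close> may have changed.\<close>

definition agree_off :: "'a set \<Rightarrow> ('a \<Rightarrow> 'b) \<Rightarrow> ('a \<Rightarrow> 'b) \<Rightarrow> bool" where
  "agree_off A f f' \<longleftrightarrow> (\<forall>a. a \<notin> A \<longrightarrow> f' a = f a)"

lemma agree_off_refl: "agree_off A f f"
  by (simp add: agree_off_def)

lemma agree_offD: "agree_off A f f' \<Longrightarrow> a \<notin> A \<Longrightarrow> f' a = f a"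
  by (simp add: agree_off_def)

section \<open>The algorithm\<close>

text \<open>Vectors are stored in row \<open>0\<close> of a two-dimensional array, and real scalars in entry \<open>(0, 0)\<close>.\<close>

abbreviation "vec_get a e \<equiv> RGet a (NConst 0) e"
abbreviation "vec_set a e p \<equiv> RStore a (NConst 0) e p"

definition init_identity :: com where
  "init_identity = For ''i'' (NVar ''N'') (RStore ''Q'' (NVar ''i'') (NVar ''i'') (ROfNat (NConst 1)))"

definition project_row :: com where
  "project_row = For ''i'' (NVar ''N'')
     (Seq (vec_set ''D'' (NVar ''i'') (ROfNat (NConst 0)))
       (For ''j'' (NVar ''N'')
         (vec_set ''D'' (NVar ''i'') (RAdd (vec_get ''D'' (NVar ''i''))
           (RMul (RGet ''Q'' (NVar ''i'') (NVar ''j'')) (vec_get ''R'' (NVar ''j'')))))))"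

definition square_norm :: com where
  "square_norm = Seq (vec_set ''s'' (NConst 0) (ROfNat (NConst 0)))
     (For ''i'' (NVar ''N'')
       (vec_set ''s'' (NConst 0) (RAdd (vec_get ''s'' (NConst 0))
         (RMul (vec_get ''D'' (NVar ''i'')) (vec_get ''D'' (NVar ''i''))))))"

definition subtract_projection :: com where
  "subtract_projection = For ''i'' (NVar ''N'') (For ''j'' (NVar ''N'')
     (RStore ''Q'' (NVar ''i'') (NVar ''j'') (RSub (RGet ''Q'' (NVar ''i'') (NVar ''j''))
       (RDiv (RMul (vec_get ''D'' (NVar ''i'')) (vec_get ''D'' (NVar ''j'')))
         (vec_get ''s'' (NConst 0))))))"

text \<open>
  Replaces the projector in array \<open>Q\<close> by its deflation with the functional in array \<open>R\<close>. The
  image of the functional goes to \<open>D\<close> and its squared norm to \<open>s\<close>.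
\<close>

definition impose :: com where
  "impose = Seq project_row (Seq square_norm subtract_projection)"

text \<open>The functionals are the \<open>n\<close> coordinates of the points, that is, the rows of the matrix \<open>A\<close>.\<close>

definition project_kernel :: com where
  "project_kernel = Seq init_identity
     (For ''r'' (NVar ''n'')
       (Seq (For ''j'' (NVar ''N'') (vec_set ''R'' (NVar ''j'') (RGet ''X'' (NVar ''j'') (NVar ''r''))))
         impose))"

text \<open>
  Goes once through all columns and makes a perceptron step whenever the current column allows it.
  Since some column always does, each sweep makes at least one step, and no search is needed.
\<close>

definition sweep :: com where
  "sweep = For ''i'' (NVar ''N'')
     (Cond (RLess (vec_get ''V'' (NVar ''i'')) (vec_get ''C'' (NVar ''i''))) Skip
       (Seq (vec_set ''C'' (NVar ''i'') (RAdd (vec_get ''C'' (NVar ''i'')) (ROfNat (NConst 1))))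
         (For ''j'' (NVar ''N'')
           (vec_set ''V'' (NVar ''j'') (RAdd (vec_get ''V'' (NVar ''j''))
              (RGet ''Q'' (NVar ''j'') (NVar ''i'')))))))"

text \<open>
  Nesting three loops gives the \<open>N (k + 1)\<^sup>2\<close> sweeps required by \<open>perceptron_bounds\<close>
  with loop limits that the input bounds linearly.
\<close>

definition perceptron :: com where
  "perceptron = For ''a'' (NVar ''N'') (For ''b'' (NAdd (NVar ''k'') (NConst 1))
     (For ''c'' (NAdd (NVar ''k'') (NConst 1)) sweep))"

definition positive_part :: com where
  "positive_part = For ''i'' (NVar ''N'')
     (Seq (Cond (RLess (ROfNat (NConst 0)) (vec_get ''V'' (NVar ''i'')))
            (vec_set ''L'' (NVar ''i'') (vec_get ''V'' (NVar ''i''))) Skip)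
       (vec_set ''S'' (NConst 0) (RAdd (vec_get ''S'' (NConst 0)) (vec_get ''L'' (NVar ''i'')))))"

definition impose_mass :: com where
  "impose_mass = Seq (For ''j'' (NVar ''N'') (vec_set ''R'' (NVar ''j'') (ROfNat (NConst 1)))) impose"

text \<open>The ratio test: the index is kept in entry \<open>0\<close> of the array \<open>p\<close>.\<close>

definition find_pivot :: com where
  "find_pivot = Seq (NStore ''p'' (NConst 0) (NVar ''b''))
     (For ''i'' (NVar ''N'')
       (Cond (BAnd (RLess (ROfNat (NConst 0)) (RGet ''Q'' (NVar ''i'') (NVar ''b'')))
                   (RLess (RDiv (vec_get ''L'' (NVar ''i'')) (RGet ''Q'' (NVar ''i'') (NVar ''b'')))
                      (RDiv (vec_get ''L'' (NGet ''p'' (NConst 0)))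
                        (RGet ''Q'' (NGet ''p'' (NConst 0)) (NVar ''b'')))))
         (NStore ''p'' (NConst 0) (NVar ''i'')) Skip))"

definition move_to_boundary :: com where
  "move_to_boundary =
     Seq (vec_set ''T'' (NConst 0) (RDiv (vec_get ''L'' (NGet ''p'' (NConst 0)))
            (RGet ''Q'' (NGet ''p'' (NConst 0)) (NVar ''b''))))
       (For ''i'' (NVar ''N'') (vec_set ''L'' (NVar ''i'') (RSub (vec_get ''L'' (NVar ''i''))
         (RMul (vec_get ''T'' (NConst 0)) (RGet ''Q'' (NVar ''i'') (NVar ''b''))))))"

definition impose_zero :: com where
  "impose_zero = Seq (For ''j'' (NVar ''N'') (vec_set ''R'' (NVar ''j'') (ROfNat (NConst 0))))
     (Seq (vec_set ''R'' (NGet ''p'' (NConst 0)) (ROfNat (NConst 1))) impose)"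

text \<open>
  A column may need several pivots before its diagonal entry vanishes, but a sweep over all columns
  makes at least one pivot unless \<open>Q = 0\<close>, and each pivot fixes a new coordinate. So \<open>N\<close> sweeps
  suffice.
\<close>

definition reduce_support :: com where
  "reduce_support = For ''a'' (NVar ''N'') (For ''b'' (NVar ''N'')
     (Cond (RLess (ROfNat (NConst 0)) (RGet ''Q'' (NVar ''b'') (NVar ''b'')))
       (Seq find_pivot (Seq move_to_boundary impose_zero)) Skip))"

text \<open>Appends a point to the output array \<open>U\<close>; entry \<open>0\<close> of the array \<open>c\<close> counts the points.\<close>

definition emit :: "nexp \<Rightarrow> com" where
  "emit e = Seq (For ''j'' (NVar ''n'')
       (RStore ''U'' (NGet ''c'' (NConst 0)) (NVar ''j'') (RGet ''X'' e (NVar ''j''))))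
     (NStore ''c'' (NConst 0) (NAdd (NGet ''c'' (NConst 0)) (NConst 1)))"

text \<open>
  Emits point \<open>i\<close> while the remaining weight \<open>Z\<close> is positive, which rounds \<open>c L i / S\<close> up
  without an operation for rounding. The subtractions compute \<open>c = k + 1 - min N (n + 1)\<close>, as
  \<open>N - (N - (n + 1))\<close> is the minimum in truncated arithmetic. Since \<open>c L i / S \<le> k\<close>, the inner
  loop is long enough.
\<close>

definition emit_rounded :: com where
  "emit_rounded = For ''i'' (NVar ''N'')
     (Seq (vec_set ''Z'' (NConst 0) (RDiv (RMul
         (ROfNat (NSub (NAdd (NVar ''k'') (NConst 1))
           (NSub (NVar ''N'') (NSub (NVar ''N'') (NAdd (NVar ''n'') (NConst 1))))))
         (vec_get ''L'' (NVar ''i''))) (vec_get ''S'' (NConst 0))))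
       (For ''a'' (NVar ''k'')
         (Cond (RLess (ROfNat (NConst 0)) (vec_get ''Z'' (NConst 0)))
           (Seq (emit (NVar ''i''))
             (vec_set ''Z'' (NConst 0) (RSub (vec_get ''Z'' (NConst 0)) (ROfNat (NConst 1)))))
           Skip)))"

definition emit_padding :: com where
  "emit_padding = For ''a'' (NVar ''k'')
     (Cond (NLess (NGet ''c'' (NConst 0)) (NVar ''k'')) (emit (NConst 0)) Skip)"

definition select_points :: com where
  "select_points = Seq project_kernel (Seq perceptron (Seq positive_part (Seq impose_mass
     (Seq reduce_support (Seq emit_rounded emit_padding)))))"

lemmas program_defs = select_points_def init_identity_def project_row_def
  square_norm_def subtract_projection_def impose_def project_kernel_def sweep_def
  perceptron_def positive_part_def impose_mass_def find_pivot_def move_to_boundary_def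
  impose_zero_def reduce_support_def emit_def emit_rounded_def emit_padding_def

text \<open>Nested loops have distinct counters, and every loop limit is \<open>n\<close>, \<open>k\<close>, \<open>k + 1\<close> or \<open>N\<close>.\<close>

lemma polytime_select_points: "polytime select_points"
  unfolding program_defs
  by (intro polytime_Seq polytime_Cond polytime_For polytime_Skip polytime_RStore polytime_NStore;
      simp add: assigned_For inputs_def input_size_def)

section \<open>Correctness of the projection and perceptron phases\<close>

lemma impose_spec:
  assumes E: "E ''N'' = N" "E ''i'' = 0" "E ''j'' = 0"
  shows "wlp E impose (\<lambda>h' g'. h' = h \<and> agree_off {''D'', ''s'', ''Q''} g g' \<and>
    (\<forall>i<N. \<forall>j<N. g' ''Q'' i j = deflate N (g ''Q'') (g ''R'' 0) i j)) h g"
proof -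
  define v where "v l = (\<Sum>j<N. g ''Q'' l j * g ''R'' 0 j)" for l
  define \<sigma> where "\<sigma> i = (\<Sum>l<i. v l * v l)" for i
  define A where "A i h' g' \<longleftrightarrow> h' = h \<and> agree_off {''D''} g g' \<and> (\<forall>l<i. g' ''D'' 0 l = v l)"
    for i and h' :: "name \<Rightarrow> nat \<Rightarrow> nat" and g'
  define B where "B i h' g' \<longleftrightarrow> h' = h \<and> agree_off {''D'', ''s''} g g' \<and> (\<forall>l<N. g' ''D'' 0 l = v l) \<and>
    g' ''s'' 0 0 = \<sigma> i"
    for i and h' :: "name \<Rightarrow> nat \<Rightarrow> nat" and g'
  define C where "C i j h' g' \<longleftrightarrow> h' = h \<and> agree_off {''D'', ''s'', ''Q''} g g' \<and> (\<forall>l<N. g' ''D'' 0 l = v l) \<and>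
    g' ''s'' 0 0 = \<sigma> N \<and> (\<forall>l<N. \<forall>l'<N. g' ''Q'' l l' =
      (if l < i \<or> l = i \<and> l' < j then g ''Q'' l l' - v l * v l' / \<sigma> N else g ''Q'' l l'))"
    for i j and h' :: "name \<Rightarrow> nat \<Rightarrow> nat" and g'
  have row: "wlp E project_row (A N) h g"
    unfolding project_row_def
  proof (rule wlp_For[where I = A and m = N])
    fix i h' g' assume "i < N" "A i h' g'"
    then show "wlp (E(''i'' := i))
      (Seq (vec_set ''D'' (NVar ''i'') (ROfNat (NConst 0)))
         (For ''j'' (NVar ''N'')
           (vec_set ''D'' (NVar ''i'') (RAdd (vec_get ''D'' (NVar ''i''))
             (RMul (RGet ''Q'' (NVar ''i'') (NVar ''j'')) (vec_get ''R'' (NVar ''j'')))))))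
       (A (Suc i)) h' g'"
      using E
      by (intro wlp_Seq wlp_RStore wlp_For[where m = N and
            I = "\<lambda>j h' g'. A i h' g' \<and> g' ''D'' 0 i = (\<Sum>l<j. g ''Q'' i l * g ''R'' 0 l)"])
        (auto simp: A_def agree_off_def v_def less_Suc_eq)
  qed (use E in \<open>auto simp: A_def agree_off_def\<close>)
  have norm: "wlp E square_norm (B N) h' g'" if "A N h' g'" for h' g'
    unfolding square_norm_def using E that
    by (intro wlp_Seq wlp_RStore wlp_For[where m = N and I = B])
      (auto simp: A_def B_def \<sigma>_def agree_off_def)
  have upd: "wlp E subtract_projection (C N 0) h' g'" if "B N h' g'" for h' g'
    unfolding subtract_projection_def
  proof (rule wlp_For[where m = N and I = "\<lambda>i. C i 0"])
    show "C i 0 h' g' \<Longrightarrow> i < N \<Longrightarrow> wlp (E(''i'' := i)) (For ''j'' (NVar ''N'')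
         (RStore ''Q'' (NVar ''i'') (NVar ''j'') (RSub (RGet ''Q'' (NVar ''i'') (NVar ''j''))
           (RDiv (RMul (vec_get ''D'' (NVar ''i'')) (vec_get ''D'' (NVar ''j'')))
             (vec_get ''s'' (NConst 0)))))) (C (Suc i) 0) h' g'" for i h' g'
      using E by (intro wlp_For[where m = N and I = "C i"] wlp_RStore)
        (auto simp: C_def agree_off_def less_Suc_eq)
    show "C 0 0 h' g'" using that by (auto simp: B_def C_def agree_off_def)
  qed (use E in simp_all)
  have "wlp E impose (C N 0) h g"
    unfolding impose_def by (intro wlp_Seq_via[OF row] wlp_Seq_via[OF norm] upd)
  then show ?thesis
    by (rule wlp_mono) (simp add: C_def deflate_def v_def \<sigma>_def power2_eq_square)
qed

lemma project_kernel_spec: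
  assumes E: "E ''N'' = N" "E ''n'' = n" "E ''r'' = 0" "E ''i'' = 0" "E ''j'' = 0"
    and X: "\<And>j r. j < N \<Longrightarrow> r < n \<Longrightarrow> g ''X'' j r = x j r"
    and Q: "\<And>i j. g ''Q'' i j = 0"
  shows "wlp E project_kernel (\<lambda>h' g'. h' = h \<and> agree_off {''R'', ''D'', ''s'', ''Q''} g g' \<and>
    kernel_projector N ((\<lambda>r j. x j r) ` {..<n}) (g' ''Q'') \<and>
    real N \<le> (\<Sum>i<N. g' ''Q'' i i) + real n) h g"
proof -
  define A where "A i h' g' \<longleftrightarrow> h' = h \<and> agree_off {''Q''} g g' \<and>
      (\<forall>a b. g' ''Q'' a b = (if a = b \<and> a < i then 1 else 0))"
    for i and h' :: "name \<Rightarrow> nat \<Rightarrow> nat" and g'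
  define B where "B r h' g' \<longleftrightarrow> h' = h \<and> agree_off {''R'', ''D'', ''s'', ''Q''} g g' \<and>
      kernel_projector N ((\<lambda>r j. x j r) ` {..<r}) (g' ''Q'') \<and>
      real N \<le> (\<Sum>i<N. g' ''Q'' i i) + real r"
    for r and h' :: "name \<Rightarrow> nat \<Rightarrow> nat" and g'
  have 1: "wlp E init_identity (B 0) h g"
    unfolding init_identity_def
  proof (rule wlp_For[where m = N and I = A])
    show "B 0 h' g'" if "A N h' g'" for h' g'
    proof -
      have "kernel_projector N {} (g' ''Q'')"
        using that by (intro kernel_projector_cong[OF kernel_projector_identity]) (auto simp: A_def)
      then show ?thesis using that by (auto simp: A_def B_def agree_off_def)
    qed
  qed (use E Q in \<open>auto intro!: wlp_RStore simp: A_def agree_off_def\<close>)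
  have load: "wlp (E(''r'' := r)) (For ''j'' (NVar ''N'') (vec_set ''R'' (NVar ''j'') (RGet ''X'' (NVar ''j'') (NVar ''r''))))
      (\<lambda>h'' g''. h'' = h' \<and> agree_off {''R''} g' g'' \<and> (\<forall>l<N. g'' ''R'' 0 l = x l r)) h' g'"
    if "B r h' g'" "r < n" for r h' g'
    using that E X
    by (intro wlp_For[where m = N and
          I = "\<lambda>j h'' g''. h'' = h' \<and> agree_off {''R''} g' g'' \<and> (\<forall>l<j. g'' ''R'' 0 l = x l r)"] wlp_RStore)
      (auto simp: agree_off_def B_def less_Suc_eq)
  have step: "wlp (E(''r'' := r))
      (Seq (For ''j'' (NVar ''N'') (vec_set ''R'' (NVar ''j'') (RGet ''X'' (NVar ''j'') (NVar ''r'')))) impose)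
      (B (Suc r)) h' g'" if "B r h' g'" "r < n" for r h' g'
  proof (rule wlp_Seq_via[OF load[OF that]])
    fix h1 g1 assume 1: "h1 = h' \<and> agree_off {''R''} g' g1 \<and> (\<forall>l<N. g1 ''R'' 0 l = x l r)"
    show "wlp (E(''r'' := r)) impose (B (Suc r)) h1 g1"
    proof (rule wlp_mono[OF impose_spec])
      fix h2 g2
      assume 2: "h2 = h1 \<and> agree_off {''D'', ''s'', ''Q''} g1 g2 \<and>
        (\<forall>i<N. \<forall>j<N. g2 ''Q'' i j = deflate N (g1 ''Q'') (g1 ''R'' 0) i j)"
      have 3: "g2 ''Q'' i j = deflate N (g' ''Q'') (\<lambda>j. x j r) i j" if "i < N" "j < N" for i j
        using 1 2 that deflate_cong[of N "g1 ''Q''" "g' ''Q''" "g1 ''R'' 0" "\<lambda>j. x j r" i j]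
        by (auto simp: agree_off_def)
      have "kernel_projector N (insert (\<lambda>j. x j r) ((\<lambda>r j. x j r) ` {..<r})) (g2 ''Q'')"
        using that(1) 3 by (intro kernel_projector_cong[OF kernel_projector_deflate]) (auto simp: B_def)
      moreover have "real N \<le> (\<Sum>i<N. g2 ''Q'' i i) + real (Suc r)"
        using that(1) 3 trace_deflate[of "g' ''Q''" N "\<lambda>j. x j r"] by (simp add: B_def)
      ultimately show "B (Suc r) h2 g2"
        using 1 2 that(1) by (auto simp: B_def agree_off_def lessThan_Suc)
    qed (use E in simp_all)
  qed
  show ?thesis
    unfolding project_kernel_def
    by (rule wlp_Seq_via[OF 1], rule wlp_For[where m = n and I = B]) (use E step in \<open>auto simp: B_def\<close>)
qed

text \<open>
  If no step had been made in the whole sweep, every coordinate would have been found to satisfy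
  \<open>V i < C i\<close>, which contradicts the existence of the probability vector \<open>l\<close> in the kernel.
\<close>

lemma sweep_spec:
  assumes E: "E ''N'' = N" "E ''i'' = 0" "E ''j'' = 0"
    and Q: "kernel_projector N R (g ''Q'')"
    and l: "\<And>i. i < N \<Longrightarrow> 0 \<le> l i" "(\<Sum>i<N. l i) = 1" "\<And>r. r \<in> R \<Longrightarrow> (\<Sum>i<N. r i * l i) = 0"
    and inv: "perceptron_inv N (g ''Q'') (g ''C'' 0) (g ''V'' 0)"
  shows "wlp E sweep (\<lambda>h' g'. h' = h \<and> agree_off {''C'', ''V''} g g' \<and>
      perceptron_inv N (g ''Q'') (g' ''C'' 0) (g' ''V'' 0) \<and>
      (\<Sum>i<N. g ''C'' 0 i) + 1 \<le> (\<Sum>i<N. g' ''C'' 0 i)) h g"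
proof -
  define M where "M = (\<Sum>i<N. g ''C'' 0 i)"
  define A where "A i h' g' \<longleftrightarrow> h' = h \<and> agree_off {''C'', ''V''} g g' \<and>
      perceptron_inv N (g ''Q'') (g' ''C'' 0) (g' ''V'' 0) \<and>
      (M + 1 \<le> (\<Sum>i<N. g' ''C'' 0 i) \<or> M \<le> (\<Sum>i<N. g' ''C'' 0 i) \<and> (\<forall>l<i. g' ''V'' 0 l < g' ''C'' 0 l))"
    for i and h' :: "name \<Rightarrow> nat \<Rightarrow> nat" and g'
  have add: "wlp (E(''i'' := i)) (For ''j'' (NVar ''N'')
           (vec_set ''V'' (NVar ''j'') (RAdd (vec_get ''V'' (NVar ''j''))
              (RGet ''Q'' (NVar ''j'') (NVar ''i'')))))
      (\<lambda>h'' g''. h'' = h' \<and> agree_off {''V''} g' g'' \<and> (\<forall>l<N. g'' ''V'' 0 l = g' ''V'' 0 l + g' ''Q'' l i)) h' g'" for i h' g'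
    using E
    by (intro wlp_For[where m = N and I = "\<lambda>j h'' g''. h'' = h' \<and> agree_off {''V''} g' g'' \<and>
          (\<forall>l. g'' ''V'' 0 l = (if l < j then g' ''V'' 0 l + g' ''Q'' l i else g' ''V'' 0 l))"] wlp_RStore)
      (auto simp: agree_off_def less_Suc_eq)
  show ?thesis
    unfolding sweep_def
  proof (rule wlp_For[where m = N and I = A])
    fix i h' g' assume i: "i < N" and A: "A i h' g'"
    show "wlp (E(''i'' := i)) (Cond (RLess (vec_get ''V'' (NVar ''i'')) (vec_get ''C'' (NVar ''i''))) Skip
       (Seq (vec_set ''C'' (NVar ''i'') (RAdd (vec_get ''C'' (NVar ''i'')) (ROfNat (NConst 1))))
         (For ''j'' (NVar ''N'')
           (vec_set ''V'' (NVar ''j'') (RAdd (vec_get ''V'' (NVar ''j''))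
              (RGet ''Q'' (NVar ''j'') (NVar ''i''))))))) (A (Suc i)) h' g'"
    proof (rule wlp_Cond, goal_cases)
      case 1
      then show ?case using A by (intro wlp_Skip) (auto simp: A_def less_Suc_eq)
    next
      case 2
      then have le: "g' ''C'' 0 i \<le> g' ''V'' 0 i" by simp
      have QQ: "g' ''Q'' = g ''Q''" using A by (simp add: A_def agree_off_def)
      show ?case
      proof (rule wlp_Seq, rule wlp_RStore, rule wlp_mono[OF add])
        fix h2 g2
        let ?g1 = "g'(''C'' := (g' ''C'')(nval (NConst 0) \<lparr>nvar = E(''i'' := i), narr = h', rarr = g'\<rparr> :=
            (g' ''C'' (nval (NConst 0) \<lparr>nvar = E(''i'' := i), narr = h', rarr = g'\<rparr>))
            (nval (NVar ''i'') \<lparr>nvar = E(''i'' := i), narr = h', rarr = g'\<rparr> :=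
             rval (RAdd (vec_get ''C'' (NVar ''i'')) (ROfNat (NConst 1))) \<lparr>nvar = E(''i'' := i), narr = h', rarr = g'\<rparr>)))"
        assume "h2 = h' \<and> agree_off {''V''} ?g1 g2 \<and> (\<forall>l<N. g2 ''V'' 0 l = ?g1 ''V'' 0 l + ?g1 ''Q'' l i)"
        then have 2: "h2 = h'" "agree_off {''V''} ?g1 g2" "\<And>l. l < N \<Longrightarrow> g2 ''V'' 0 l = g' ''V'' 0 l + g ''Q'' l i"
          by (auto simp: QQ)
        have C: "g2 ''C'' 0 l = (if l = i then g' ''C'' 0 i + 1 else g' ''C'' 0 l)" for l
          using agree_offD[OF 2(2), of "''C''"] by simp
        have "perceptron_inv N (g ''Q'') (g' ''C'' 0) (g' ''V'' 0)" using A by (simp add: A_def)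
        note step = perceptron_step[OF Q this i le C 2(3)]
        have "agree_off {''C'', ''V''} g g2"
          using A 2(2) unfolding A_def agree_off_def by simp
        moreover have "M \<le> (\<Sum>i<N. g' ''C'' 0 i)" using A unfolding A_def by linarith
        then have "M + 1 \<le> (\<Sum>i<N. g2 ''C'' 0 i)" using step(2) by simp
        ultimately show "A (Suc i) h2 g2"
          using A 2(1) step(1) unfolding A_def by blast
      qed
    qed
  next
    fix h' g' assume A: "A N h' g'"
    obtain i where "i < N" "g' ''C'' 0 i \<le> g' ''V'' 0 i"
      using perceptron_violated_coordinate[OF Q _ l, of "g' ''C'' 0" "g' ''V'' 0"] A by (auto simp: A_def)
    then have "M + 1 \<le> (\<Sum>i<N. g' ''C'' 0 i)" using A by (force simp: A_def)
    then show "h' = h \<and> agree_off {''C'', ''V''} g g' \<and>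
      perceptron_inv N (g ''Q'') (g' ''C'' 0) (g' ''V'' 0) \<and>
      (\<Sum>i<N. g ''C'' 0 i) + 1 \<le> (\<Sum>i<N. g' ''C'' 0 i)" using A by (simp add: A_def M_def)
  qed (use E inv in \<open>auto simp: A_def M_def agree_off_def\<close>)
qed

lemma perceptron_spec:
  assumes E: "E ''N'' = N" "E ''k'' = k" "E ''i'' = 0" "E ''j'' = 0" "E ''a'' = 0" "E ''b'' = 0" "E ''c'' = 0"
    and Q: "kernel_projector N R (g ''Q'')"
    and l: "\<And>i. i < N \<Longrightarrow> 0 \<le> l i" "(\<Sum>i<N. l i) = 1" "\<And>r. r \<in> R \<Longrightarrow> (\<Sum>i<N. r i * l i) = 0"
    and init: "\<And>i. g ''C'' 0 i = 0" "\<And>i. g ''V'' 0 i = 0"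
  shows "wlp E perceptron (\<lambda>h' g'. h' = h \<and> agree_off {''C'', ''V''} g g' \<and>
      perceptron_inv N (g ''Q'') (g' ''C'' 0) (g' ''V'' 0) \<and>
      real N * (real k + 1)\<^sup>2 \<le> (\<Sum>i<N. g' ''C'' 0 i)) h g"
proof -
  \<comment> \<open>\<open>m\<close> counts the sweeps of all three loops.\<close>
  define A where "A m h' g' \<longleftrightarrow> h' = h \<and> agree_off {''C'', ''V''} g g' \<and>
      perceptron_inv N (g ''Q'') (g' ''C'' 0) (g' ''V'' 0) \<and> real m \<le> (\<Sum>i<N. g' ''C'' 0 i)"
    for m and h' :: "name \<Rightarrow> nat \<Rightarrow> nat" and g'
  have sweep: "wlp (E(''a'' := a, ''b'' := b, ''c'' := c)) sweep (A (Suc m)) h' g'"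
    if "A m h' g'" for a b c m h' g'
  proof (rule wlp_mono[OF sweep_spec[where R = R and l = l]])
    have "g' ''Q'' = g ''Q''" using that by (simp add: A_def agree_off_def)
    then show "kernel_projector N R (g' ''Q'')" "perceptron_inv N (g' ''Q'') (g' ''C'' 0) (g' ''V'' 0)"
      using Q that by (simp_all add: A_def)
    show "A (Suc m) h2 g2" if "h2 = h' \<and> agree_off {''C'', ''V''} g' g2 \<and>
      perceptron_inv N (g' ''Q'') (g2 ''C'' 0) (g2 ''V'' 0) \<and>
      (\<Sum>i<N. g' ''C'' 0 i) + 1 \<le> (\<Sum>i<N. g2 ''C'' 0 i)" for h2 g2
      using that \<open>A m h' g'\<close> \<open>g' ''Q'' = g ''Q''\<close> by (auto simp: A_def agree_off_def)
  qed (use E l in auto)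
  have inner: "wlp (E(''a'' := a, ''b'' := b)) (For ''c'' (NAdd (NVar ''k'') (NConst 1)) sweep) (A (m + (k + 1))) h' g'"
    if "A m h' g'" for a b m h' g'
    by (rule wlp_For[where m = "k + 1" and I = "\<lambda>c. A (m + c)"]) (use E that sweep in auto)
  have middle: "wlp (E(''a'' := a)) (For ''b'' (NAdd (NVar ''k'') (NConst 1))
      (For ''c'' (NAdd (NVar ''k'') (NConst 1)) sweep)) (A (m + (k + 1) * (k + 1))) h' g'"
    if "A m h' g'" for a m h' g'
  proof (rule wlp_For[where m = "k + 1" and I = "\<lambda>b. A (m + b * (k + 1))"])
    fix b h1 g1 assume "A (m + b * (k + 1)) h1 g1"
    from inner[OF this, of a b] show "wlp (E(''a'' := a, ''b'' := b)) (For ''c'' (NAdd (NVar ''k'') (NConst 1)) sweep)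
       (A (m + Suc b * (k + 1))) h1 g1" by (simp add: algebra_simps)
  qed (use E that in auto)
  have 0: "A 0 h g" using init by (simp add: A_def agree_off_def perceptron_inv_def)
  show ?thesis
    unfolding perceptron_def
  proof (rule wlp_For[where m = N and I = "\<lambda>a. A (a * ((k + 1) * (k + 1)))"])
    fix a h1 g1 assume "A (a * ((k + 1) * (k + 1))) h1 g1"
    from middle[OF this, of a] show "wlp (E(''a'' := a)) (For ''b'' (NAdd (NVar ''k'') (NConst 1))
      (For ''c'' (NAdd (NVar ''k'') (NConst 1)) sweep)) (A (Suc a * ((k + 1) * (k + 1)))) h1 g1"
      by (simp add: algebra_simps)
  next
    fix h' g' assume "A (N * ((k + 1) * (k + 1))) h' g'"
    then show "h' = h \<and> agree_off {''C'', ''V''} g g' \<and>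
      perceptron_inv N (g ''Q'') (g' ''C'' 0) (g' ''V'' 0) \<and>
      real N * (real k + 1)\<^sup>2 \<le> (\<Sum>i<N. g' ''C'' 0 i)"
      by (simp add: A_def power2_eq_square algebra_simps)
  qed (use E 0 in auto)
qed

lemma positive_part_spec:
  assumes E: "E ''N'' = N" "E ''i'' = 0"
    and init: "\<And>i. g ''L'' 0 i = 0" "g ''S'' 0 0 = 0"
  shows "wlp E positive_part (\<lambda>h' g'. h' = h \<and> agree_off {''L'', ''S''} g g' \<and>
      (\<forall>i<N. g' ''L'' 0 i = max 0 (g ''V'' 0 i)) \<and> g' ''S'' 0 0 = (\<Sum>i<N. max 0 (g ''V'' 0 i))) h g"
proof -
  define A where "A i h' g' \<longleftrightarrow> h' = h \<and> agree_off {''L'', ''S''} g g' \<and>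
      (\<forall>l. g' ''L'' 0 l = (if l < i then max 0 (g ''V'' 0 l) else 0)) \<and>
      g' ''S'' 0 0 = (\<Sum>l<i. max 0 (g ''V'' 0 l))"
    for i and h' :: "name \<Rightarrow> nat \<Rightarrow> nat" and g'
  show ?thesis
    unfolding positive_part_def
  proof (rule wlp_For[where m = N and I = A])
    fix i h' g' assume A: "A i h' g'"
    then have V: "g' ''V'' = g ''V''" by (simp add: A_def agree_off_def)
    show "wlp (E(''i'' := i)) (Seq (Cond (RLess (ROfNat (NConst 0)) (vec_get ''V'' (NVar ''i'')))
            (vec_set ''L'' (NVar ''i'') (vec_get ''V'' (NVar ''i''))) Skip)
       (vec_set ''S'' (NConst 0) (RAdd (vec_get ''S'' (NConst 0)) (vec_get ''L'' (NVar ''i''))))) (A (Suc i)) h' g'"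
    proof (rule wlp_Seq, rule wlp_Cond, goal_cases)
      case 1
      then have "0 < g ''V'' 0 i" using V by simp
      then show ?case using A V
        by (intro wlp_RStore) (simp add: A_def agree_off_def less_Suc_eq)
    next
      case 2
      then have "g ''V'' 0 i \<le> 0" using V by simp
      then show ?case using A V
        by (intro wlp_RStore wlp_Skip) (simp add: A_def agree_off_def less_Suc_eq)
    qed
  qed (use E init in \<open>simp_all add: A_def agree_off_def\<close>)
qed

lemma impose_mass_spec:
  assumes E: "E ''N'' = N" "E ''i'' = 0" "E ''j'' = 0"
  shows "wlp E impose_mass (\<lambda>h' g'. h' = h \<and> agree_off {''R'', ''D'', ''s'', ''Q''} g g' \<and>
      (\<forall>i<N. \<forall>j<N. g' ''Q'' i j = deflate N (g ''Q'') (\<lambda>_. 1) i j)) h g"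
  unfolding impose_mass_def
proof (rule wlp_Seq_via)
  show "wlp E (For ''j'' (NVar ''N'') (vec_set ''R'' (NVar ''j'') (ROfNat (NConst 1))))
    (\<lambda>h' g'. h' = h \<and> agree_off {''R''} g g' \<and> (\<forall>l<N. g' ''R'' 0 l = 1)) h g"
    using E by (intro wlp_For[where m = N and I = "\<lambda>j h' g'. h' = h \<and> agree_off {''R''} g g' \<and> (\<forall>l<j. g' ''R'' 0 l = 1)"]
        wlp_RStore) (auto simp: agree_off_def less_Suc_eq)
  fix h' g' assume 1: "h' = h \<and> agree_off {''R''} g g' \<and> (\<forall>l<N. g' ''R'' 0 l = 1)"
  then have "deflate N (g' ''Q'') (g' ''R'' 0) i j = deflate N (g ''Q'') (\<lambda>_. 1) i j" if "i < N" "j < N" for i j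
    using that by (intro deflate_cong) (auto simp: agree_off_def)
  then show "wlp E impose (\<lambda>h' g'. h' = h \<and> agree_off {''R'', ''D'', ''s'', ''Q''} g g' \<and>
      (\<forall>i<N. \<forall>j<N. g' ''Q'' i j = deflate N (g ''Q'') (\<lambda>_. 1) i j)) h' g'"
    using 1 by (intro wlp_mono[OF impose_spec[OF E]]) (auto simp: agree_off_def)
qed

section \<open>Correctness of the support reduction and of the output\<close>

lemma find_pivot_spec:
  assumes E: "E ''N'' = N" "E ''b'' = b" "E ''i'' = 0" and b: "b < N" "0 < g ''Q'' b b"
  shows "wlp E find_pivot (\<lambda>h' g'. g' = g \<and> agree_off {''p''} h h' \<and>
      h' ''p'' 0 < N \<and> 0 < g ''Q'' (h' ''p'' 0) b \<and>
      (\<forall>i<N. 0 < g ''Q'' i b \<longrightarrow>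
         g ''L'' 0 (h' ''p'' 0) / g ''Q'' (h' ''p'' 0) b \<le> g ''L'' 0 i / g ''Q'' i b)) h g"
proof -
  define A where "A i h' g' \<longleftrightarrow> g' = g \<and> agree_off {''p''} h h' \<and>
      h' ''p'' 0 < N \<and> 0 < g ''Q'' (h' ''p'' 0) b \<and>
      (\<forall>l<i. 0 < g ''Q'' l b \<longrightarrow>
         g ''L'' 0 (h' ''p'' 0) / g ''Q'' (h' ''p'' 0) b \<le> g ''L'' 0 l / g ''Q'' l b)"
    for i h' and g' :: "name \<Rightarrow> nat \<Rightarrow> nat \<Rightarrow> real"
  have 0: "wlp E (NStore ''p'' (NConst 0) (NVar ''b'')) (A 0) h g"
    using E b by (intro wlp_NStore) (simp add: A_def agree_off_def)
  show ?thesis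
    unfolding find_pivot_def
  proof (rule wlp_Seq_via[OF 0], rule wlp_For[where m = N and I = A])
    fix i h' g' assume i: "i < N" and A: "A i h' g'"
    then show "wlp (E(''i'' := i))
       (Cond (BAnd (RLess (ROfNat (NConst 0)) (RGet ''Q'' (NVar ''i'') (NVar ''b'')))
                   (RLess (RDiv (vec_get ''L'' (NVar ''i'')) (RGet ''Q'' (NVar ''i'') (NVar ''b'')))
                      (RDiv (vec_get ''L'' (NGet ''p'' (NConst 0)))
                        (RGet ''Q'' (NGet ''p'' (NConst 0)) (NVar ''b'')))))
         (NStore ''p'' (NConst 0) (NVar ''i'')) Skip) (A (Suc i)) h' g'"
    proof (intro wlp_Cond, goal_cases)
      case 1
      then show ?case using E
        by (intro wlp_NStore) (fastforce simp: A_def agree_off_def less_Suc_eq)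
    next
      case 2
      then show ?case using E
        by (intro wlp_Skip) (auto simp: A_def agree_off_def less_Suc_eq)
    qed
  qed (use E in \<open>auto simp: A_def\<close>)
qed

lemma move_to_boundary_spec:
  assumes E: "E ''N'' = N" "E ''b'' = b" "E ''i'' = 0" and p: "h ''p'' 0 = p"
  shows "wlp E move_to_boundary (\<lambda>h' g'. h' = h \<and> agree_off {''T'', ''L''} g g' \<and>
      (\<forall>i<N. g' ''L'' 0 i = g ''L'' 0 i - g ''L'' 0 p / g ''Q'' p b * g ''Q'' i b)) h g"
  unfolding move_to_boundary_def
  using E p by (intro wlp_Seq wlp_RStore wlp_For[where m = N and I = "\<lambda>i h' g'. h' = h \<and>
      agree_off {''T'', ''L''} g g' \<and> g' ''T'' 0 0 = g ''L'' 0 p / g ''Q'' p b \<and>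
      (\<forall>l. g' ''L'' 0 l = (if l < i then g ''L'' 0 l - g ''L'' 0 p / g ''Q'' p b * g ''Q'' l b else g ''L'' 0 l))"])
    (auto simp: agree_off_def less_Suc_eq)

lemma impose_zero_spec:
  assumes E: "E ''N'' = N" "E ''i'' = 0" "E ''j'' = 0" and p: "h ''p'' 0 = p"
  shows "wlp E impose_zero (\<lambda>h' g'. h' = h \<and> agree_off {''R'', ''D'', ''s'', ''Q''} g g' \<and>
      (\<forall>i<N. \<forall>j<N. g' ''Q'' i j = deflate N (g ''Q'') (unit p) i j)) h g"
proof -
  have clear: "wlp E (For ''j'' (NVar ''N'') (vec_set ''R'' (NVar ''j'') (ROfNat (NConst 0))))
    (\<lambda>h' g'. h' = h \<and> agree_off {''R''} g g' \<and> (\<forall>l<N. g' ''R'' 0 l = 0)) h g"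
    using E by (intro wlp_For[where m = N and I = "\<lambda>j h' g'. h' = h \<and> agree_off {''R''} g g' \<and> (\<forall>l<j. g' ''R'' 0 l = 0)"]
        wlp_RStore) (auto simp: agree_off_def less_Suc_eq)
  have set: "wlp E (vec_set ''R'' (NGet ''p'' (NConst 0)) (ROfNat (NConst 1)))
      (\<lambda>h' g'. h' = h \<and> agree_off {''R''} g g' \<and> (\<forall>l<N. g' ''R'' 0 l = unit p l)) h' g'"
    if "h' = h \<and> agree_off {''R''} g g' \<and> (\<forall>l<N. g' ''R'' 0 l = 0)" for h' g'
    using that p by (intro wlp_RStore) (auto simp: agree_off_def unit_def)
  show ?thesis
    unfolding impose_zero_def
  proof (rule wlp_Seq_via[OF clear wlp_Seq_via[OF set]], assumption)
    fix h1 g1 assume 1: "h1 = h \<and> agree_off {''R''} g g1 \<and> (\<forall>l<N. g1 ''R'' 0 l = unit p l)"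
    then have "deflate N (g1 ''Q'') (g1 ''R'' 0) i j = deflate N (g ''Q'') (unit p) i j" if "i < N" "j < N" for i j
      using that by (intro deflate_cong) (auto simp: agree_off_def)
    then show "wlp E impose (\<lambda>h' g'. h' = h \<and> agree_off {''R'', ''D'', ''s'', ''Q''} g g' \<and>
      (\<forall>i<N. \<forall>j<N. g' ''Q'' i j = deflate N (g ''Q'') (unit p) i j)) h1 g1"
      using 1 by (intro wlp_mono[OF impose_spec[OF E]]) (auto simp: agree_off_def)
  qed
qed

lemma pivot_spec:
  assumes E: "E ''N'' = N" "E ''b'' = b" "E ''i'' = 0" "E ''j'' = 0" and b: "b < N" "0 < g ''Q'' b b"
    and inv: "reduction_inv N R q l Z (g ''Q'') (g ''L'' 0)"
  shows "wlp E (Seq find_pivot (Seq move_to_boundary impose_zero))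
    (\<lambda>h' g'. agree_off {''p''} h h' \<and> agree_off {''T'', ''L'', ''R'', ''D'', ''s'', ''Q''} g g' \<and>
      (\<exists>p. p \<notin> Z \<and> reduction_inv N R q l (insert p Z) (g' ''Q'') (g' ''L'' 0))) h g"
proof (rule wlp_Seq_via[OF find_pivot_spec[where g = g, OF E(1-3) b]
      wlp_Seq_via[OF move_to_boundary_spec[OF E(1-3) refl] wlp_mono[OF impose_zero_spec[OF E(1,3,4) refl]]]])
  fix h1 h2 h3 :: "name \<Rightarrow> nat \<Rightarrow> nat" and g1 g2 g3
  let ?p = "h1 ''p'' 0"
  assume 1: "g1 = g \<and> agree_off {''p''} h h1 \<and> ?p < N \<and> 0 < g ''Q'' ?p b \<and>
      (\<forall>i<N. 0 < g ''Q'' i b \<longrightarrow> g ''L'' 0 ?p / g ''Q'' ?p b \<le> g ''L'' 0 i / g ''Q'' i b)"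
    and 2: "h2 = h1 \<and> agree_off {''T'', ''L''} g1 g2 \<and>
      (\<forall>i<N. g2 ''L'' 0 i = g1 ''L'' 0 i - g1 ''L'' 0 ?p / g1 ''Q'' ?p b * g1 ''Q'' i b)"
    and 3: "h3 = h2 \<and> agree_off {''R'', ''D'', ''s'', ''Q''} g2 g3 \<and>
      (\<forall>i<N. \<forall>j<N. g3 ''Q'' i j = deflate N (g2 ''Q'') (unit (h2 ''p'' 0)) i j)"
  have "g3 ''L'' = g2 ''L''" "g2 ''Q'' = g ''Q''" using 1 2 3 by (auto simp: agree_off_def)
  then have "?p \<notin> Z \<and> reduction_inv N R q l (insert ?p Z) (g3 ''Q'') (g3 ''L'' 0)"
    using 1 2 3 reduction_pivot[OF inv b(1), of ?p "g3 ''L'' 0" "g3 ''Q''"] by auto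
  then show "agree_off {''p''} h h3 \<and> agree_off {''T'', ''L'', ''R'', ''D'', ''s'', ''Q''} g g3 \<and>
      (\<exists>p. p \<notin> Z \<and> reduction_inv N R q l (insert p Z) (g3 ''Q'') (g3 ''L'' 0))"
    using 1 2 3 by (auto simp: agree_off_def)
qed

text \<open>
  Each sweep either makes a pivot, so that the number of fixed coordinates grows, or it finds every
  diagonal entry of \<open>Q\<close> to be zero, after which nothing changes any more.
\<close>

lemma reduce_support_spec:
  assumes E: "E ''N'' = N" "E ''a'' = 0" "E ''b'' = 0" "E ''i'' = 0" "E ''j'' = 0"
    and init: "reduction_inv N R q l {} (g ''Q'') (g ''L'' 0)"
  shows "wlp E reduce_support
    (\<lambda>h' g'. agree_off {''p''} h h' \<and> agree_off {''T'', ''L'', ''R'', ''D'', ''s'', ''Q''} g g' \<and>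
      (\<exists>Z. reduction_inv N R q l Z (g' ''Q'') (g' ''L'' 0) \<and>
           card {i. i < N \<and> g' ''L'' 0 i \<noteq> 0} \<le> min N q)) h g"
proof -
  define fr where "fr h' g' \<longleftrightarrow> agree_off {''p''} h h' \<and>
      agree_off {''T'', ''L'', ''R'', ''D'', ''s'', ''Q''} g g'" for h' g'
  define A where "A a h' g' \<longleftrightarrow> fr h' g' \<and> (\<exists>Z. reduction_inv N R q l Z (g' ''Q'') (g' ''L'' 0) \<and>
      (a \<le> card Z \<or> (\<forall>i<N. g' ''Q'' i i = 0)))" for a h' g'
  \<comment> \<open>During sweep \<open>a\<close>, before column \<open>b\<close>: either a pivot was made, or the diagonal vanishes below \<open>b\<close>.\<close>
  define B where "B a b h' g' \<longleftrightarrow> fr h' g' \<and> (\<exists>Z. reduction_inv N R q l Z (g' ''Q'') (g' ''L'' 0) \<and>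
      (Suc a \<le> card Z \<or> (\<forall>i<b. g' ''Q'' i i = 0) \<and> (a \<le> card Z \<or> (\<forall>i<N. g' ''Q'' i i = 0))))"
    for a b h' g'
  have step: "wlp (E(''a'' := a, ''b'' := b)) (Cond (RLess (ROfNat (NConst 0)) (RGet ''Q'' (NVar ''b'') (NVar ''b'')))
       (Seq find_pivot (Seq move_to_boundary impose_zero)) Skip) (B a (Suc b)) h' g'"
    if b: "b < N" and B: "B a b h' g'" for a b h' g'
  proof -
    obtain Z where Z: "fr h' g'" "reduction_inv N R q l Z (g' ''Q'') (g' ''L'' 0)"
      "Suc a \<le> card Z \<or> (\<forall>i<b. g' ''Q'' i i = 0) \<and> (a \<le> card Z \<or> (\<forall>i<N. g' ''Q'' i i = 0))"
      using B unfolding B_def by blast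
    show ?thesis
    proof (rule wlp_Cond, goal_cases)
      case 1
      then have pos: "0 < g' ''Q'' b b" by simp
      have "finite Z" using Z(2) finite_subset by (auto simp: reduction_inv_def)
      show ?case
      proof (rule wlp_mono[OF pivot_spec[OF _ _ _ _ b pos Z(2)]])
        fix h2 g2
        assume 2: "agree_off {''p''} h' h2 \<and> agree_off {''T'', ''L'', ''R'', ''D'', ''s'', ''Q''} g' g2 \<and>
          (\<exists>p. p \<notin> Z \<and> reduction_inv N R q l (insert p Z) (g2 ''Q'') (g2 ''L'' 0))"
        then obtain p where p: "p \<notin> Z" "reduction_inv N R q l (insert p Z) (g2 ''Q'') (g2 ''L'' 0)"
          by blast
        have "a \<le> card Z" using Z(3) pos b by fastforce
        then have "Suc a \<le> card (insert p Z)" using p(1) \<open>finite Z\<close> by simp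
        moreover have "fr h2 g2" using Z(1) 2 by (simp add: fr_def agree_off_def)
        ultimately show "B a (Suc b) h2 g2" using p(2) unfolding B_def by blast
      qed (use E in auto)
    next
      case 2
      have "0 \<le> g' ''Q'' b b"
        using Z(2) b kernel_projector_diagonal[of N "R \<union> unit ` Z" "g' ''Q''" b]
        by (simp add: reduction_inv_def sum_nonneg)
      then have "g' ''Q'' b b = 0" using 2 by simp
      then have "Suc a \<le> card Z \<or> (\<forall>i<Suc b. g' ''Q'' i i = 0) \<and> (a \<le> card Z \<or> (\<forall>i<N. g' ''Q'' i i = 0))"
        using Z(3) by (auto simp: less_Suc_eq)
      then show ?case using Z(1,2) by (intro wlp_Skip) (auto simp: B_def)
    qed
  qed
  have inner: "wlp (E(''a'' := a)) (For ''b'' (NVar ''N'')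
      (Cond (RLess (ROfNat (NConst 0)) (RGet ''Q'' (NVar ''b'') (NVar ''b'')))
       (Seq find_pivot (Seq move_to_boundary impose_zero)) Skip)) (A (Suc a)) h' g'"
    if "A a h' g'" for a h' g'
  proof (rule wlp_For[where m = N and I = "B a"])
    show "B a 0 h' g'" using that unfolding A_def B_def by auto
    show "B a N h1 g1 \<Longrightarrow> A (Suc a) h1 g1" for h1 g1 unfolding A_def B_def by blast
  qed (use E step in auto)
  show ?thesis
    unfolding reduce_support_def
  proof (rule wlp_For[where m = N and I = A])
    fix h' g' assume "A N h' g'"
    then obtain Z where Z: "fr h' g'" "reduction_inv N R q l Z (g' ''Q'') (g' ''L'' 0)"
      "N \<le> card Z \<or> (\<forall>i<N. g' ''Q'' i i = 0)" unfolding A_def by blast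
    then show "agree_off {''p''} h h' \<and> agree_off {''T'', ''L'', ''R'', ''D'', ''s'', ''Q''} g g' \<and>
      (\<exists>Z. reduction_inv N R q l Z (g' ''Q'') (g' ''L'' 0) \<and>
           card {i. i < N \<and> g' ''L'' 0 i \<noteq> 0} \<le> min N q)"
      using reduction_support[OF Z(2,3)] unfolding fr_def by blast
  qed (use E inner init in \<open>auto simp: A_def fr_def agree_off_refl\<close>)
qed

definition outputs :: "nat \<Rightarrow> nat \<Rightarrow> (name \<Rightarrow> nat \<Rightarrow> nat) \<Rightarrow> (name \<Rightarrow> nat \<Rightarrow> nat \<Rightarrow> real) \<Rightarrow> nat list \<Rightarrow> bool" where
  "outputs N n h g us \<longleftrightarrow> length us = h ''c'' 0 \<and> set us \<subseteq> {..<N} \<and>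
     (\<forall>t<length us. \<forall>j<n. g ''U'' t j = g ''X'' (us ! t) j)"

lemma emit_spec:
  assumes E: "E ''n'' = n" "E ''j'' = 0"
    and e: "\<And>j h g. nval e \<lparr>nvar = E(''j'' := j), narr = h, rarr = g\<rparr> = i" and i: "i < N"
    and out: "outputs N n h g us"
  shows "wlp E (emit e) (\<lambda>h' g'. agree_off {''c''} h h' \<and> agree_off {''U''} g g' \<and>
      outputs N n h' g' (us @ [i])) h g"
proof -
  have copy: "wlp E (For ''j'' (NVar ''n'')
       (RStore ''U'' (NGet ''c'' (NConst 0)) (NVar ''j'') (RGet ''X'' e (NVar ''j''))))
     (\<lambda>h' g'. h' = h \<and> agree_off {''U''} g g' \<and>
       (\<forall>t j. g' ''U'' t j = (if t = h ''c'' 0 \<and> j < n then g ''X'' i j else g ''U'' t j))) h g"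
    using E e by (intro wlp_RStore wlp_For[where m = n and I = "\<lambda>m h' g'. h' = h \<and> agree_off {''U''} g g' \<and>
       (\<forall>t j. g' ''U'' t j = (if t = h ''c'' 0 \<and> j < m then g ''X'' i j else g ''U'' t j))"])
      (auto simp: agree_off_def less_Suc_eq)
  show ?thesis
    unfolding emit_def
  proof (rule wlp_Seq_via[OF copy], rule wlp_NStore)
    fix h' g' assume "h' = h \<and> agree_off {''U''} g g' \<and>
       (\<forall>t j. g' ''U'' t j = (if t = h ''c'' 0 \<and> j < n then g ''X'' i j else g ''U'' t j))"
    then show "agree_off {''c''} h (h'(''c'' := (h' ''c'')
        (nval (NConst 0) \<lparr>nvar = E, narr = h', rarr = g'\<rparr> :=
         nval (NAdd (NGet ''c'' (NConst 0)) (NConst 1)) \<lparr>nvar = E, narr = h', rarr = g'\<rparr>))) \<and>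
      agree_off {''U''} g g' \<and>
      outputs N n (h'(''c'' := (h' ''c'')
        (nval (NConst 0) \<lparr>nvar = E, narr = h', rarr = g'\<rparr> :=
         nval (NAdd (NGet ''c'' (NConst 0)) (NConst 1)) \<lparr>nvar = E, narr = h', rarr = g'\<rparr>))) g' (us @ [i])"
      using out i by (auto simp: outputs_def agree_off_def nth_append less_Suc_eq)
  qed
qed

lemma emit_rounded_spec:
  assumes E: "E ''N'' = N" "E ''n'' = n" "E ''k'' = k" "E ''i'' = 0" "E ''a'' = 0" "E ''j'' = 0"
    and \<mu>: "\<And>i. \<mu> i = real (k + 1 - min N (n + 1)) * g ''L'' 0 i / g ''S'' 0 0"
    and le: "\<And>i. i < N \<Longrightarrow> \<mu> i \<le> real k"
    and init: "h ''c'' 0 = 0"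
  shows "wlp E emit_rounded (\<lambda>h' g'. agree_off {''c''} h h' \<and> agree_off {''Z'', ''U''} g g' \<and>
      (\<exists>us. outputs N n h' g' us \<and> (\<forall>i<N. \<mu> i \<le> real (count_list us i) \<and>
         (count_list us i = 0 \<or> 0 < \<mu> i \<and> real (count_list us i) < \<mu> i + 1)))) h g"
proof -
  define fr where "fr h' g' \<longleftrightarrow> agree_off {''c''} h h' \<and> agree_off {''Z'', ''U''} g g'" for h' g'
  define ok where "ok us i \<longleftrightarrow> \<mu> i \<le> real (count_list us i) \<and>
         (count_list us i = 0 \<or> 0 < \<mu> i \<and> real (count_list us i) < \<mu> i + 1)" for us i
  define A where "A i h' g' \<longleftrightarrow> fr h' g' \<and> (\<exists>us. outputs N n h' g' us \<and> (\<forall>l<i. ok us l) \<and>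
      (\<forall>l\<ge>i. count_list us l = 0))" for i h' g'
  \<comment> \<open>After \<open>a\<close> rounds for point \<open>i\<close>. As long as \<open>Z > 0\<close>, every round has emitted the point;
    so \<open>Z > 0\<close> after \<open>k\<close> rounds would mean \<open>\<mu> i > k\<close>.\<close>
  define B where "B i a h' g' \<longleftrightarrow> fr h' g' \<and> (\<exists>us. outputs N n h' g' us \<and> (\<forall>l<i. ok us l) \<and>
      (\<forall>l>i. count_list us l = 0) \<and> g' ''Z'' 0 0 = \<mu> i - real (count_list us i) \<and>
      (0 < g' ''Z'' 0 0 \<longrightarrow> count_list us i = a) \<and>
      (count_list us i = 0 \<or> 0 < \<mu> i \<and> real (count_list us i) < \<mu> i + 1))" for i a h' g'
  have step: "wlp (E(''i'' := i, ''a'' := a))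
         (Cond (RLess (ROfNat (NConst 0)) (vec_get ''Z'' (NConst 0)))
           (Seq (emit (NVar ''i''))
             (vec_set ''Z'' (NConst 0) (RSub (vec_get ''Z'' (NConst 0)) (ROfNat (NConst 1)))))
           Skip) (B i (Suc a)) h' g'" if i: "i < N" and B: "B i a h' g'" for i a h' g'
  proof -
    obtain us where us: "outputs N n h' g' us" "\<forall>l<i. ok us l" "\<forall>l>i. count_list us l = 0"
      "g' ''Z'' 0 0 = \<mu> i - real (count_list us i)" "0 < g' ''Z'' 0 0 \<longrightarrow> count_list us i = a"
      "count_list us i = 0 \<or> 0 < \<mu> i \<and> real (count_list us i) < \<mu> i + 1" and fr: "fr h' g'"
      using B unfolding B_def by blast
    show ?thesis
    proof (rule wlp_Cond, goal_cases)
      case 1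
      then have pos: "0 < g' ''Z'' 0 0" by simp
      show ?case
      proof (rule wlp_Seq_via[OF emit_spec[OF _ _ _ i us(1)] wlp_RStore])
        fix h2 g2 assume 2: "agree_off {''c''} h' h2 \<and> agree_off {''U''} g' g2 \<and> outputs N n h2 g2 (us @ [i])"
        then have Z: "g2 ''Z'' = g' ''Z''" by (simp add: agree_off_def)
        let ?g = "g2(''Z'' := (g2 ''Z'')(0 := (g2 ''Z'' 0)(0 := g2 ''Z'' 0 0 - 1)))"
        have "outputs N n h2 ?g (us @ [i])"
          using 2 by (simp add: outputs_def)
        moreover have "fr h2 ?g" using fr 2 by (simp add: fr_def agree_off_def)
        moreover have "\<forall>l<i. ok (us @ [i]) l" using us(2) by (simp add: ok_def)
        ultimately have "B i (Suc a) h2 ?g"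
          unfolding B_def using us pos Z by (intro conjI exI[of _ "us @ [i]"]) auto
        then show "B i (Suc a) h2
          (g2(''Z'' := (g2 ''Z'')(nval (NConst 0) \<lparr>nvar = E(''i'' := i, ''a'' := a), narr = h2, rarr = g2\<rparr> :=
            (g2 ''Z'' (nval (NConst 0) \<lparr>nvar = E(''i'' := i, ''a'' := a), narr = h2, rarr = g2\<rparr>))
            (nval (NConst 0) \<lparr>nvar = E(''i'' := i, ''a'' := a), narr = h2, rarr = g2\<rparr> :=
             rval (RSub (vec_get ''Z'' (NConst 0)) (ROfNat (NConst 1)))
               \<lparr>nvar = E(''i'' := i, ''a'' := a), narr = h2, rarr = g2\<rparr>))))" by simp
      qed (use E in auto)
    next
      case 2
      then show ?case using us fr by (intro wlp_Skip) (auto simp: B_def)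
    qed
  qed
  have row: "wlp (E(''i'' := i)) (Seq (vec_set ''Z'' (NConst 0) (RDiv (RMul
         (ROfNat (NSub (NAdd (NVar ''k'') (NConst 1))
           (NSub (NVar ''N'') (NSub (NVar ''N'') (NAdd (NVar ''n'') (NConst 1))))))
         (vec_get ''L'' (NVar ''i''))) (vec_get ''S'' (NConst 0))))
       (For ''a'' (NVar ''k'')
         (Cond (RLess (ROfNat (NConst 0)) (vec_get ''Z'' (NConst 0)))
           (Seq (emit (NVar ''i''))
             (vec_set ''Z'' (NConst 0) (RSub (vec_get ''Z'' (NConst 0)) (ROfNat (NConst 1)))))
           Skip))) (A (Suc i)) h' g'" if i: "i < N" and A: "A i h' g'" for i h' g'
  proof (rule wlp_Seq_via[where A = "B i 0"])
    obtain us where us: "outputs N n h' g' us" "\<forall>l<i. ok us l" "\<forall>l\<ge>i. count_list us l = 0" "fr h' g'"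
      using A unfolding A_def by blast
    have LS: "g' ''L'' = g ''L''" "g' ''S'' = g ''S''"
      using us(4) by (auto simp: fr_def agree_off_def)
    let ?g = "g'(''Z'' := (g' ''Z'')(0 := (g' ''Z'' 0)(0 := \<mu> i)))"
    have "N - (N - (n + 1)) = min N (n + 1)" by simp
    then have rv: "rval (RDiv (RMul
         (ROfNat (NSub (NAdd (NVar ''k'') (NConst 1))
           (NSub (NVar ''N'') (NSub (NVar ''N'') (NAdd (NVar ''n'') (NConst 1))))))
         (vec_get ''L'' (NVar ''i''))) (vec_get ''S'' (NConst 0))) \<lparr>nvar = E(''i'' := i), narr = h', rarr = g'\<rparr> = \<mu> i"
      using E LS by (simp add: \<mu> del: of_nat_diff)
    have "outputs N n h' ?g us" using us(1) by (simp add: outputs_def)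
    moreover have "fr h' ?g" using us(4) by (simp add: fr_def agree_off_def)
    ultimately have "B i 0 h' ?g"
      unfolding B_def using us(2,3) by (intro conjI exI[of _ us]) auto
    then show "wlp (E(''i'' := i)) (vec_set ''Z'' (NConst 0) (RDiv (RMul
         (ROfNat (NSub (NAdd (NVar ''k'') (NConst 1))
           (NSub (NVar ''N'') (NSub (NVar ''N'') (NAdd (NVar ''n'') (NConst 1))))))
         (vec_get ''L'' (NVar ''i''))) (vec_get ''S'' (NConst 0)))) (B i 0) h' g'"
      by (intro wlp_RStore) (simp only: rv nval.simps)
  next
    fix h1 g1 assume B: "B i 0 h1 g1"
    show "wlp (E(''i'' := i)) (For ''a'' (NVar ''k'')
         (Cond (RLess (ROfNat (NConst 0)) (vec_get ''Z'' (NConst 0)))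
           (Seq (emit (NVar ''i''))
             (vec_set ''Z'' (NConst 0) (RSub (vec_get ''Z'' (NConst 0)) (ROfNat (NConst 1)))))
           Skip)) (A (Suc i)) h1 g1"
    proof (rule wlp_For[where m = k and I = "B i"])
      fix h2 g2 assume "B i k h2 g2"
      then obtain us where us: "outputs N n h2 g2 us" "\<forall>l<i. ok us l" "\<forall>l>i. count_list us l = 0"
        "g2 ''Z'' 0 0 = \<mu> i - real (count_list us i)" "0 < g2 ''Z'' 0 0 \<longrightarrow> count_list us i = k"
        "count_list us i = 0 \<or> 0 < \<mu> i \<and> real (count_list us i) < \<mu> i + 1" and fr: "fr h2 g2"
        unfolding B_def by blast
      have "\<mu> i \<le> real (count_list us i)" using us(4,5) le[OF i] by (cases "0 < g2 ''Z'' 0 0") auto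
      then have "ok us i" using us(6) by (simp add: ok_def)
      then have "\<forall>l<Suc i. ok us l" using us(2) by (simp add: less_Suc_eq)
      then show "A (Suc i) h2 g2" using us(1,3) fr unfolding A_def by (auto simp: Suc_le_eq)
    qed (use E B step[OF i] in auto)
  qed
  show ?thesis
    unfolding emit_rounded_def
  proof (rule wlp_For[where m = N and I = A])
    have "outputs N n h g []" using init by (simp add: outputs_def)
    then show "A 0 h g" unfolding A_def by (auto simp: fr_def agree_off_refl intro!: exI[of _ "[]"])
    show "A N h' g' \<Longrightarrow> agree_off {''c''} h h' \<and> agree_off {''Z'', ''U''} g g' \<and>
      (\<exists>us. outputs N n h' g' us \<and> (\<forall>i<N. \<mu> i \<le> real (count_list us i) \<and>
         (count_list us i = 0 \<or> 0 < \<mu> i \<and> real (count_list us i) < \<mu> i + 1)))" for h' g'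
      unfolding A_def fr_def ok_def by blast
  qed (use E row in auto)
qed

lemma emit_padding_spec:
  assumes E: "E ''n'' = n" "E ''k'' = k" "E ''a'' = 0" "E ''j'' = 0" and N: "0 < N"
    and us: "outputs N n h g us" "length us \<le> k"
  shows "wlp E emit_padding (\<lambda>h' g'. agree_off {''U''} g g' \<and>
      (\<exists>us'. outputs N n h' g' us' \<and> length us' = k \<and> (\<forall>i. count_list us i \<le> count_list us' i))) h g"
proof -
  define A where "A a h' g' \<longleftrightarrow> agree_off {''U''} g g' \<and>
      (\<exists>us'. outputs N n h' g' us' \<and> a \<le> length us' \<and> length us' \<le> k \<and>
        (\<forall>i. count_list us i \<le> count_list us' i))" for a h' g'
  show ?thesis
    unfolding emit_padding_def
  proof (rule wlp_For[where m = k and I = A])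
    fix a h' g' assume a: "a < k" and A: "A a h' g'"
    obtain us' where us': "outputs N n h' g' us'" "a \<le> length us'" "length us' \<le> k"
      "\<forall>i. count_list us i \<le> count_list us' i" and fr: "agree_off {''U''} g g'"
      using A unfolding A_def by blast
    have len: "length us' = h' ''c'' 0" using us'(1) by (simp add: outputs_def)
    show "wlp (E(''a'' := a)) (Cond (NLess (NGet ''c'' (NConst 0)) (NVar ''k'')) (emit (NConst 0)) Skip)
       (A (Suc a)) h' g'"
    proof (rule wlp_Cond, goal_cases)
      case 1
      then have lt: "length us' < k" using len E by simp
      show ?case
      proof (rule wlp_mono[OF emit_spec[OF _ _ _ N us'(1)]])
        fix h2 g2 assume "agree_off {''c''} h' h2 \<and> agree_off {''U''} g' g2 \<and> outputs N n h2 g2 (us' @ [0])"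
        then show "A (Suc a) h2 g2"
          unfolding A_def using fr us' lt
          by (intro conjI exI[of _ "us' @ [0]"]) (auto simp: agree_off_def trans_le_add1)
      qed (use E in auto)
    next
      case 2
      then have "Suc a \<le> length us'" using len E a by simp
      then show ?case using us' fr by (intro wlp_Skip) (auto simp: A_def)
    qed
  next
    show "A 0 h g" using us by (auto simp: A_def agree_off_refl)
    show "A k h' g' \<Longrightarrow> agree_off {''U''} g g' \<and>
      (\<exists>us'. outputs N n h' g' us' \<and> length us' = k \<and> (\<forall>i. count_list us i \<le> count_list us' i))" for h' g'
      unfolding A_def using le_antisym by blast
  qed (use E in auto)
qed

section \<open>Correctness of the algorithm\<close>

lemma sum_fun_apply: "(\<Sum>i\<in>A. f i) r = (\<Sum>i\<in>A. f i r :: 'b::comm_monoid_add)"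
  by (induction A rule: infinite_finite_induct) auto

text \<open>
  The intermediate assertions record what each phase hands over to the next one. What survives to
  the end is that \<open>L\<close> has mass \<open>S > 0\<close> and that \<open>\<Sum>L i x i = \<Sum>D i x i\<close> for some
  \<open>D \<ge> 0\<close> of mass at most \<open>S / k\<close>; here \<open>D\<close> is the negative part of the kernel vector whose
  positive part is the initial value of \<open>L\<close>.
\<close>

lemma select_points_spec:
  fixes x :: "nat \<Rightarrow> nat \<Rightarrow> real"
  assumes E: "E ''N'' = N" "E ''n'' = n" "E ''k'' = k" "E ''r'' = 0" "E ''i'' = 0" "E ''j'' = 0"
      "E ''a'' = 0" "E ''b'' = 0" "E ''c'' = 0"
    and g: "g = (\<lambda>a i j. 0)(''X'' := (\<lambda>i j. if i < N \<and> j < n then x i j else 0))"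
    and h: "h = (\<lambda>a i. 0)"
    and x: "\<And>i. i < N \<Longrightarrow> x i \<in> Rn n"
    and l: "\<And>i. i < N \<Longrightarrow> 0 \<le> l i" "(\<Sum>i<N. l i) = 1" "(\<Sum>i<N. l i *\<^sub>R x i) = 0"
    and N: "0 < N" and k: "0 < k"
  shows "wlp E select_points (\<lambda>h' g'. \<exists>us. length us = k \<and> set us \<subseteq> {..<N} \<and>
      (\<forall>t<k. \<forall>j<n. g' ''U'' t j = x (us ! t) j) \<and>
      (\<forall>K. convex K \<longrightarrow> (\<forall>i<N. x i \<in> K) \<longrightarrow>
         gauge_norm K ((1 / real k) *\<^sub>R (\<Sum>t<k. x (us ! t))) \<le> ereal (real (min N (n + 1)) / real k))) h g"
proof -
  define R where "R = (\<lambda>r j. x j r) ` {..<n}"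
  define P1 where "P1 h' g' \<longleftrightarrow> h' = h \<and> agree_off {''R'', ''D'', ''s'', ''Q''} g g' \<and>
    kernel_projector N R (g' ''Q'') \<and> real N \<le> (\<Sum>i<N. g' ''Q'' i i) + real n" for h' g'
  define P2 where "P2 h' g' \<longleftrightarrow> h' = h \<and> agree_off {''R'', ''D'', ''s'', ''Q'', ''C'', ''V''} g g' \<and>
    kernel_projector N R (g' ''Q'') \<and> real N \<le> (\<Sum>i<N. g' ''Q'' i i) + real n \<and>
    perceptron_inv N (g' ''Q'') (g' ''C'' 0) (g' ''V'' 0) \<and>
    real N * (real k + 1)\<^sup>2 \<le> (\<Sum>i<N. g' ''C'' 0 i)" for h' g'
  define good where "good L S \<longleftrightarrow> (\<forall>i<N. 0 \<le> L i) \<and> S = (\<Sum>i<N. L i) \<and> 0 < S \<and>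
    (\<exists>D. (\<forall>i<N. 0 \<le> D i) \<and> real k * (\<Sum>i<N. D i) \<le> S \<and>
       (\<forall>r<n. (\<Sum>i<N. x i r * L i) = (\<Sum>i<N. x i r * D i)))" for L :: "nat \<Rightarrow> real" and S :: real
  define P3 where "P3 h' g' \<longleftrightarrow> h' = h \<and> g' ''X'' = g ''X'' \<and>
    kernel_projector N R (g' ''Q'') \<and> real N \<le> (\<Sum>i<N. g' ''Q'' i i) + real n \<and>
    good (g' ''L'' 0) (g' ''S'' 0 0)" for h' :: "name \<Rightarrow> nat \<Rightarrow> nat" and g'
  \<comment> \<open>One more functional, the total mass, gives the bound \<open>n + 1\<close> on the support.\<close>
  define P4 where "P4 h' g' \<longleftrightarrow> h' = h \<and> g' ''X'' = g ''X'' \<and>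
    kernel_projector N (insert (\<lambda>_. 1) R) (g' ''Q'') \<and> real N \<le> (\<Sum>i<N. g' ''Q'' i i) + real (n + 1) \<and>
    good (g' ''L'' 0) (g' ''S'' 0 0)" for h' :: "name \<Rightarrow> nat \<Rightarrow> nat" and g'
  define m where "m = min N (n + 1)"
  define P5 where "P5 h' g' \<longleftrightarrow> h' ''c'' 0 = 0 \<and> g' ''X'' = g ''X'' \<and>
    good (g' ''L'' 0) (g' ''S'' 0 0) \<and> card {i. i < N \<and> g' ''L'' 0 i \<noteq> 0} \<le> m"
    for h' :: "name \<Rightarrow> nat \<Rightarrow> nat" and g' :: "name \<Rightarrow> nat \<Rightarrow> nat \<Rightarrow> real"
  define c where "c = k + 1 - m"
  define P6 where "P6 h' g' \<longleftrightarrow> g' ''X'' = g ''X'' \<and> (\<exists>L S us. good L S \<and> outputs N n h' g' us \<and>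
      length us \<le> k \<and> (\<forall>i<N. real c * L i / S \<le> real (count_list us i)))" for h' g'
  have m: "0 < m" using N by (simp add: m_def)
  have lR: "(\<Sum>i<N. r i * l i) = 0" if "r \<in> R" for r
  proof -
    obtain q where "r = (\<lambda>j. x j q)" using \<open>r \<in> R\<close> by (auto simp: R_def)
    moreover have "(\<Sum>i<N. l i *\<^sub>R x i) q = 0" by (simp add: l(3))
    ultimately show ?thesis by (simp add: sum_fun_apply scaleR_fun_def mult.commute)
  qed
  have 1: "wlp E project_kernel P1 h g"
    using E g by (intro wlp_mono[OF project_kernel_spec[where n = n and N = N and x = x]]) (auto simp: P1_def R_def)
  have 2: "wlp E perceptron P2 h' g'" if "P1 h' g'" for h' g'
  proof (rule wlp_mono[OF perceptron_spec[where R = R and l = l]])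
    show "g' ''C'' 0 i = 0" "g' ''V'' 0 i = 0" for i
      using that g by (auto simp: P1_def agree_off_def)
    show "P2 h2 g2" if "h2 = h' \<and> agree_off {''C'', ''V''} g' g2 \<and>
      perceptron_inv N (g' ''Q'') (g2 ''C'' 0) (g2 ''V'' 0) \<and>
      real N * (real k + 1)\<^sup>2 \<le> (\<Sum>i<N. g2 ''C'' 0 i)" for h2 g2
      using that \<open>P1 h' g'\<close> by (auto simp: P1_def P2_def agree_off_def)
  qed (use E that l lR in \<open>auto simp: P1_def\<close>)
  have 3: "wlp E positive_part P3 h' g'" if "P2 h' g'" for h' g'
  proof (rule wlp_mono[OF positive_part_spec])
    show "g' ''L'' 0 i = 0" "g' ''S'' 0 0 = 0" for i
      using that g by (auto simp: P2_def agree_off_def)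
    fix h2 g2
    let ?V = "g' ''V'' 0"
    assume 2: "h2 = h' \<and> agree_off {''L'', ''S''} g' g2 \<and>
      (\<forall>i<N. g2 ''L'' 0 i = max 0 (?V i)) \<and> g2 ''S'' 0 0 = (\<Sum>i<N. max 0 (?V i))"
    have inv: "perceptron_inv N (g' ''Q'') (g' ''C'' 0) ?V" "real N * (real k + 1)\<^sup>2 \<le> (\<Sum>i<N. g' ''C'' 0 i)"
      and Q: "kernel_projector N R (g' ''Q'')"
      using that by (auto simp: P2_def)
    note bounds = perceptron_bounds[OF inv(1) N k inv(2)]
    have "(\<Sum>i<N. x i r * g2 ''L'' 0 i) = (\<Sum>i<N. x i r * max 0 (- ?V i))" if "r < n" for r
    proof -
      have "(\<Sum>i<N. x i r * ?V i) = (\<Sum>i<N. x i r * (\<Sum>j<N. g' ''Q'' i j * g' ''C'' 0 j))"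
        using inv(1) by (intro sum.cong) (simp_all add: perceptron_inv_def)
      also have "\<dots> = 0"
        using that by (intro kernel_projector_image[OF Q, of "\<lambda>i. x i r"]) (auto simp: R_def)
      finally have "(\<Sum>i<N. x i r * ?V i) = 0" .
      moreover have "(\<Sum>i<N. x i r * g2 ''L'' 0 i) = (\<Sum>i<N. x i r * ?V i + x i r * max 0 (- ?V i))"
        using 2 by (intro sum.cong) (auto simp: max_def algebra_simps)
      ultimately show ?thesis by (simp add: sum.distrib)
    qed
    then have "good (g2 ''L'' 0) (g2 ''S'' 0 0)"
      unfolding good_def using 2 bounds
      by (intro conjI exI[of _ "\<lambda>i. max 0 (- ?V i)"]) auto
    then show "P3 h2 g2" using that 2 by (auto simp: P2_def P3_def agree_off_def)
  qed (use E in auto)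
  have 4: "wlp E impose_mass P4 h' g'" if "P3 h' g'" for h' g'
  proof (rule wlp_mono[OF impose_mass_spec])
    fix h2 g2 assume 2: "h2 = h' \<and> agree_off {''R'', ''D'', ''s'', ''Q''} g' g2 \<and>
      (\<forall>i<N. \<forall>j<N. g2 ''Q'' i j = deflate N (g' ''Q'') (\<lambda>_. 1) i j)"
    have "kernel_projector N (insert (\<lambda>_. 1) R) (g2 ''Q'')"
      using that 2 by (intro kernel_projector_cong[OF kernel_projector_deflate]) (auto simp: P3_def)
    moreover have "real N \<le> (\<Sum>i<N. g2 ''Q'' i i) + real (n + 1)"
      using that 2 trace_deflate[of "g' ''Q''" N "\<lambda>_. 1"] by (simp add: P3_def)
    ultimately show "P4 h2 g2" using that 2 by (auto simp: P3_def P4_def agree_off_def)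
  qed (use E in auto)
  have 5: "wlp E reduce_support P5 h' g'" if "P4 h' g'" for h' g'
  proof (rule wlp_mono[OF reduce_support_spec[where R = "insert (\<lambda>_. 1) R" and q = "n + 1" and l = "g' ''L'' 0"]])
    show "reduction_inv N (insert (\<lambda>_. 1) R) (n + 1) (g' ''L'' 0) {} (g' ''Q'') (g' ''L'' 0)"
      using that by (simp add: P4_def reduction_inv_def good_def)
    fix h2 g2 assume 2: "agree_off {''p''} h' h2 \<and> agree_off {''T'', ''L'', ''R'', ''D'', ''s'', ''Q''} g' g2 \<and>
      (\<exists>Z. reduction_inv N (insert (\<lambda>_. 1) R) (n + 1) (g' ''L'' 0) Z (g2 ''Q'') (g2 ''L'' 0) \<and>
           card {i. i < N \<and> g2 ''L'' 0 i \<noteq> 0} \<le> min N (n + 1))"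
    then have L: "\<forall>i<N. 0 \<le> g2 ''L'' 0 i" "(\<Sum>i<N. g2 ''L'' 0 i) = (\<Sum>i<N. g' ''L'' 0 i)"
      "\<forall>r\<in>R. (\<Sum>i<N. r i * g2 ''L'' 0 i) = (\<Sum>i<N. r i * g' ''L'' 0 i)"
      by (auto simp: reduction_inv_def)
    have "\<forall>r<n. (\<Sum>i<N. x i r * g2 ''L'' 0 i) = (\<Sum>i<N. x i r * g' ''L'' 0 i)"
      using L(3) by (simp add: R_def)
    moreover have "g2 ''S'' = g' ''S''" using 2 by (simp add: agree_off_def)
    ultimately have "good (g2 ''L'' 0) (g2 ''S'' 0 0)"
      using that L(1,2) by (auto simp: P4_def good_def)
    then show "P5 h2 g2" using that 2 h by (auto simp: P4_def P5_def agree_off_def m_def)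
  qed (use E in auto)
  have 6: "wlp E emit_rounded P6 h' g'" if "P5 h' g'" for h' g'
  proof (rule wlp_mono[OF emit_rounded_spec])
    let ?L = "g' ''L'' 0" and ?S = "g' ''S'' 0 0"
    have good: "good ?L ?S" using that by (simp add: P5_def)
    show "real c * ?L i / ?S \<le> real k" if "i < N" for i
    proof -
      have "?L i \<le> ?S"
        using good that member_le_sum[of i "{..<N}" ?L] by (auto simp: good_def)
      then have "?L i / ?S \<le> 1" using good by (simp add: good_def)
      then have "real c * (?L i / ?S) \<le> real c * 1" by (intro mult_left_mono) auto
      also have "\<dots> \<le> real k" using m by (simp add: c_def)
      finally show ?thesis by simp
    qed
    fix h2 g2 assume 2: "agree_off {''c''} h' h2 \<and> agree_off {''Z'', ''U''} g' g2 \<and>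
      (\<exists>us. outputs N n h2 g2 us \<and> (\<forall>i<N. real c * ?L i / ?S \<le> real (count_list us i) \<and>
         (count_list us i = 0 \<or> 0 < real c * ?L i / ?S \<and> real (count_list us i) < real c * ?L i / ?S + 1)))"
    then obtain us where us: "outputs N n h2 g2 us" "\<And>i. i < N \<Longrightarrow> real c * ?L i / ?S \<le> real (count_list us i)"
      "\<And>i. i < N \<Longrightarrow> count_list us i = 0 \<or> 0 < real c * ?L i / ?S \<and> real (count_list us i) < real c * ?L i / ?S + 1"
      by blast
    have "length us \<le> k"
    proof (rule rounded_counts_length[OF c_def _ _ _ _ _ us(3)])
      show "?S = (\<Sum>i<N. ?L i)" "0 < ?S" "\<And>i. i < N \<Longrightarrow> 0 \<le> ?L i" using good by (auto simp: good_def)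
      show "card {i. i < N \<and> ?L i \<noteq> 0} \<le> m" using that by (simp add: P5_def)
      show "set us \<subseteq> {..<N}" using us(1) by (simp add: outputs_def)
    qed
    moreover have "g2 ''X'' = g ''X''" using that 2 by (simp add: P5_def agree_off_def)
    ultimately show "P6 h2 g2" unfolding P6_def using good us(1,2) by blast
  qed (use E that in \<open>auto simp: P5_def c_def m_def\<close>)
  have 7: "wlp E emit_padding (\<lambda>h' g'. \<exists>us. length us = k \<and> set us \<subseteq> {..<N} \<and>
      (\<forall>t<k. \<forall>j<n. g' ''U'' t j = x (us ! t) j) \<and>
      (\<forall>K. convex K \<longrightarrow> (\<forall>i<N. x i \<in> K) \<longrightarrow>
         gauge_norm K ((1 / real k) *\<^sub>R (\<Sum>t<k. x (us ! t))) \<le> ereal (real m / real k))) h' g'"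
    if P6: "P6 h' g'" for h' g'
  proof -
    obtain L S us where good: "good L S" and us: "outputs N n h' g' us" "length us \<le> k"
        "\<And>i. i < N \<Longrightarrow> real c * L i / S \<le> real (count_list us i)"
      and X: "g' ''X'' = g ''X''"
      using P6 unfolding P6_def by blast
    obtain D where LS: "S = (\<Sum>i<N. L i)" "0 < S"
      and D: "\<And>i. i < N \<Longrightarrow> 0 \<le> D i" "real k * (\<Sum>i<N. D i) \<le> S"
        "\<And>r. r < n \<Longrightarrow> (\<Sum>i<N. x i r * L i) = (\<Sum>i<N. x i r * D i)"
      using good unfolding good_def by blast
    have LD: "(\<Sum>i<N. L i *\<^sub>R x i) = (\<Sum>i<N. D i *\<^sub>R x i)"
    proof (rule ext)
      fix r
      show "(\<Sum>i<N. L i *\<^sub>R x i) r = (\<Sum>i<N. D i *\<^sub>R x i) r"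
      proof (cases "r < n")
        case True
        then show ?thesis using D(3) by (simp add: sum_fun_apply scaleR_fun_def mult.commute)
      next
        case False
        then have "x i r = 0" if "i < N" for i using x[OF that] by (simp add: Rn_def)
        then show ?thesis by (simp add: sum_fun_apply scaleR_fun_def)
      qed
    qed
    show ?thesis
    proof (rule wlp_mono[OF emit_padding_spec[OF _ _ _ _ N us(1,2)]])
      fix h2 g2 assume "agree_off {''U''} g' g2 \<and> (\<exists>us'. outputs N n h2 g2 us' \<and> length us' = k \<and>
        (\<forall>i. count_list us i \<le> count_list us' i))"
      then obtain us' where us': "outputs N n h2 g2 us'" "length us' = k"
          "\<And>i. count_list us i \<le> count_list us' i" and X2: "g2 ''X'' = g ''X''"
        using X by (auto simp: agree_off_def)
      have set: "set us' \<subseteq> {..<N}" using us'(1) by (simp add: outputs_def)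
      have "g2 ''U'' t j = x (us' ! t) j" if "t < k" "j < n" for t j
      proof -
        have "us' ! t < N" using set us'(2) that(1) nth_mem by fastforce
        then show ?thesis using us'(1,2) that X2 g by (simp add: outputs_def)
      qed
      moreover have "gauge_norm K ((1 / real k) *\<^sub>R (\<Sum>t<k. x (us' ! t))) \<le> ereal (real m / real k)"
        if "convex K" "\<forall>i<N. x i \<in> K" for K
      proof (rule gauge_norm_rounded_sum[OF N k m c_def LS D(1,2) LD us'(2) set])
        show "real c * L i / S \<le> real (count_list us' i)" if "i < N" for i
          using us(3)[OF that] us'(3)[of i] by linarith
      qed (use that in auto)
      ultimately show "\<exists>us. length us = k \<and> set us \<subseteq> {..<N} \<and>
        (\<forall>t<k. \<forall>j<n. g2 ''U'' t j = x (us ! t) j) \<and>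
        (\<forall>K. convex K \<longrightarrow> (\<forall>i<N. x i \<in> K) \<longrightarrow>
         gauge_norm K ((1 / real k) *\<^sub>R (\<Sum>t<k. x (us ! t))) \<le> ereal (real m / real k))"
        using us'(2) set by blast
    qed (use E in auto)
  qed
  show ?thesis
    unfolding select_points_def
    by (intro wlp_Seq_via[OF 1] wlp_Seq_via[OF 2] wlp_Seq_via[OF 3] wlp_Seq_via[OF 4] wlp_Seq_via[OF 5] wlp_Seq_via[OF 6]
        7[unfolded m_def])
qed

lemma select_points_output:
  assumes Xn: "X \<subseteq> Rn n" and bij: "bij_betw x {..<N} X" and hull: "0 \<in> convex hull X" and k: "1 \<le> k"
    and run: "exec select_points (input_state n k N x) t s"
  shows "\<forall>i<k. output_point n s i \<in> X"
    and "\<And>K. convex K \<Longrightarrow> X \<subseteq> K \<Longrightarrow>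
      gauge_norm K ((1 / real k) *\<^sub>R (\<Sum>i<k. output_point n s i)) \<le> ereal (real (min_card X n) / real k)"
proof -
  have X: "X = x ` {..<N}" and inj: "inj_on x {..<N}" using bij by (auto simp: bij_betw_def)
  have fin: "finite X" and card: "card X = N" using X inj by (auto simp: card_image)
  have N: "0 < N" using hull X by (cases N) auto
  obtain u where u: "\<And>y. y \<in> X \<Longrightarrow> 0 \<le> u y" "sum u X = 1" "(\<Sum>y\<in>X. u y *\<^sub>R y) = 0"
    using hull unfolding convex_hull_finite[OF fin] by auto
  define P where "P g' \<longleftrightarrow> (\<exists>us. length us = k \<and> set us \<subseteq> {..<N} \<and>
    (\<forall>t<k. \<forall>j<n. g' ''U'' t j = x (us ! t) j) \<and>
    (\<forall>K. convex K \<longrightarrow> (\<forall>i<N. x i \<in> K) \<longrightarrow>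
       gauge_norm K ((1 / real k) *\<^sub>R (\<Sum>t<k. x (us ! t))) \<le> ereal (real (min N (n + 1)) / real k)))" for g'
  let ?s = "input_state n k N x"
  have "wlp (nvar ?s) select_points (\<lambda>h' g'. P g') (narr ?s) (rarr ?s)"
    unfolding P_def
  proof (rule select_points_spec[where l = "u \<circ> x"])
    show "(\<Sum>i<N. (u \<circ> x) i) = 1" "(\<Sum>i<N. (u \<circ> x) i *\<^sub>R x i) = 0"
      using u(2,3) unfolding X by (simp_all add: sum.reindex[OF inj])
  qed (use N k Xn X u(1) in \<open>auto simp: input_state_def\<close>)
  moreover have "?s = \<lparr>nvar = nvar ?s, narr = narr ?s, rarr = rarr ?s\<rparr>" by simp
  ultimately have "P (rarr s)" using run unfolding wlp_def by metis
  then obtain us where us: "length us = k" "set us \<subseteq> {..<N}"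
    "\<And>t j. t < k \<Longrightarrow> j < n \<Longrightarrow> rarr s ''U'' t j = x (us ! t) j"
    "\<And>K. convex K \<Longrightarrow> (\<forall>i<N. x i \<in> K) \<Longrightarrow>
       gauge_norm K ((1 / real k) *\<^sub>R (\<Sum>t<k. x (us ! t))) \<le> ereal (real (min N (n + 1)) / real k)"
    unfolding P_def by blast
  have ust: "us ! t < N" if "t < k" for t using us(1,2) that nth_mem by fastforce
  have out: "output_point n s t = x (us ! t)" if "t < k" for t
  proof (rule ext)
    fix j
    have "x (us ! t) \<in> Rn n" using ust[OF that] Xn X by auto
    then show "output_point n s t j = x (us ! t) j"
      using us(3)[OF that] by (auto simp: output_point_def Rn_def)
  qed
  show "\<forall>i<k. output_point n s i \<in> X" using out ust X by simp
  show "gauge_norm K ((1 / real k) *\<^sub>R (\<Sum>i<k. output_point n s i)) \<le> ereal (real (min_card X n) / real k)"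
    if "convex K" "X \<subseteq> K" for K
    using us(4)[OF that(1)] that(2) X fin card out by (auto simp: min_card_def)
qed

lemma select_points_time:
  "\<exists>c d. \<forall>n N x k. 1 \<le> k \<longrightarrow>
     (\<exists>t s. exec select_points (input_state n k N x) t s \<and> t \<le> c * (N + k + n) ^ d)"
proof -
  obtain a d where ad: "\<And>s. \<exists>t s'. exec select_points s t s' \<and> t \<le> a * input_size s ^ d"
    using polytime_select_points unfolding polytime_def by blast
  have "\<exists>t s. exec select_points (input_state n k N x) t s \<and> t \<le> (a * 2 ^ d) * (N + k + n) ^ d"
    if k: "1 \<le> k" for n N k x
  proof -
    let ?s = "input_state n k N x"
    obtain t s where ts: "exec select_points ?s t s" "t \<le> a * input_size ?s ^ d" using ad by blast
    have "input_size ?s \<le> 2 * (N + k + n)"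
      using k by (simp add: input_size_def input_state_def)
    then have "a * input_size ?s ^ d \<le> a * (2 * (N + k + n)) ^ d"
      by (intro mult_le_mono2 power_mono) auto
    then have "t \<le> (a * 2 ^ d) * (N + k + n) ^ d"
      using ts(2) by (simp only: power_mult_distrib mult.assoc)
    then show ?thesis using ts(1) by blast
  qed
  then show ?thesis by blast
qed

text \<open>
  A representation of \<open>0\<close> as a convex combination uses only a finite subset \<open>Y\<close> of \<open>X\<close>, and
  the algorithm can be run on \<open>Y\<close>. The bound for \<open>Y\<close> is at least as good as the one for \<open>X\<close>.
\<close>

lemma exists_points_with_small_average:
  fixes K :: "(nat \<Rightarrow> real) set"
  assumes K: "K \<subseteq> Rn n" "convex K" "X \<subseteq> K" and hull: "0 \<in> convex hull X" and k: "k \<ge> 1"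
  shows "\<exists>u::nat \<Rightarrow> nat \<Rightarrow> real. (\<forall>i\<in>{1..k}. u i \<in> X) \<and>
     gauge_norm K ((1 / real k) *\<^sub>R (\<Sum>i=1..k. u i)) \<le> ereal (real (min_card X n) / real k)"
proof -
  obtain Y u where Y: "finite Y" "Y \<subseteq> X" and u: "\<forall>y\<in>Y. 0 \<le> u y" "sum u Y = 1" "(\<Sum>y\<in>Y. u y *\<^sub>R y) = 0"
    using hull unfolding convex_hull_explicit by auto
  have hullY: "0 \<in> convex hull Y" unfolding convex_hull_finite[OF Y(1)] using u by auto
  obtain x where bij: "bij_betw x {..<card Y} Y"
    using ex_bij_betw_nat_finite[OF Y(1)] by (auto simp: atLeast0LessThan)
  obtain t s where run: "exec select_points (input_state n k (card Y) x) t s"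
    using polytime_select_points unfolding polytime_def by blast
  have "Y \<subseteq> K" "Y \<subseteq> Rn n" using Y(2) K(1,3) by auto
  note out = select_points_output[OF \<open>Y \<subseteq> Rn n\<close> bij hullY k run]
  have "min_card Y n \<le> min_card X n"
    using Y card_mono[OF _ Y(2)] by (auto simp: min_card_def)
  then have "ereal (real (min_card Y n) / real k) \<le> ereal (real (min_card X n) / real k)"
    by (simp add: divide_right_mono)
  moreover have "(\<Sum>i=1..k. output_point n s (i - 1)) = (\<Sum>i<k. output_point n s i)"
    by (rule sum.reindex_bij_witness[of _ Suc "\<lambda>i. i - 1"]) auto
  moreover have "\<forall>i\<in>{1..k}. output_point n s (i - 1) \<in> X" using out(1) Y(2) by force
  ultimately show ?thesis
    using out(2)[OF K(2) \<open>Y \<subseteq> K\<close>]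
    by (intro exI[of _ "\<lambda>i. output_point n s (i - 1)"]) (auto intro: order_trans)
qed

theorem lemma18:
  shows "(\<forall>(n::nat) (K::(nat \<Rightarrow> real) set) X (k::nat).
            K \<subseteq> Rn n \<and> convex K \<and> X \<subseteq> K \<and> 0 \<in> convex hull X \<and> k \<ge> 1 \<longrightarrow>
            (\<exists>u::nat \<Rightarrow> nat \<Rightarrow> real. (\<forall>i\<in>{1..k}. u i \<in> X) \<and>
               gauge_norm K ((1 / real k) *\<^sub>R (\<Sum>i=1..k. u i)) \<le> ereal (real (min_card X n) / real k)))
       \<and> (\<exists>(prog::com) (c::nat) (d::nat).
            \<forall>(n::nat) (X::(nat \<Rightarrow> real) set) (N::nat) (x::nat \<Rightarrow> nat \<Rightarrow> real) (k::nat).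
              X \<subseteq> Rn n \<and> bij_betw x {..<N} X \<and> 0 \<in> convex hull X \<and> k \<ge> 1 \<longrightarrow>
              (\<exists>t s. exec prog (input_state n k N x) t s \<and>
                     t \<le> c * (card X + k + n) ^ d \<and>
                     (\<forall>i<k. output_point n s i \<in> X) \<and>
                     (\<forall>K. K \<subseteq> Rn n \<and> convex K \<and> X \<subseteq> K \<longrightarrow>
                        gauge_norm K ((1 / real k) *\<^sub>R (\<Sum>i<k. output_point n s i))
                          \<le> ereal (real (min_card X n) / real k))))"
proof (intro conjI allI impI; (elim conjE)?)
  fix n k :: nat and K X :: "(nat \<Rightarrow> real) set"
  assume "K \<subseteq> Rn n" "convex K" "X \<subseteq> K" "0 \<in> convex hull X" "1 \<le> k"
  then show "\<exists>u::nat \<Rightarrow> nat \<Rightarrow> real. (\<forall>i\<in>{1..k}. u i \<in> X) \<and>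
     gauge_norm K ((1 / real k) *\<^sub>R (\<Sum>i=1..k. u i)) \<le> ereal (real (min_card X n) / real k)"
    by (rule exists_points_with_small_average)
next
  obtain c d where cd: "\<And>n N x k. 1 \<le> k \<Longrightarrow>
      \<exists>t s. exec select_points (input_state n k N x) t s \<and> t \<le> c * (N + k + n) ^ d"
    using select_points_time by blast
  show "\<exists>(prog::com) (c::nat) (d::nat).
            \<forall>(n::nat) (X::(nat \<Rightarrow> real) set) (N::nat) (x::nat \<Rightarrow> nat \<Rightarrow> real) (k::nat).
              X \<subseteq> Rn n \<and> bij_betw x {..<N} X \<and> 0 \<in> convex hull X \<and> k \<ge> 1 \<longrightarrow>
              (\<exists>t s. exec prog (input_state n k N x) t s \<and>
                     t \<le> c * (card X + k + n) ^ d \<and>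
                     (\<forall>i<k. output_point n s i \<in> X) \<and>
                     (\<forall>K. K \<subseteq> Rn n \<and> convex K \<and> X \<subseteq> K \<longrightarrow>
                        gauge_norm K ((1 / real k) *\<^sub>R (\<Sum>i<k. output_point n s i))
                          \<le> ereal (real (min_card X n) / real k)))"
  proof (rule exI[of _ select_points], rule exI[of _ c], rule exI[of _ d], intro allI impI, elim conjE)
    fix n N k :: nat and X and x :: "nat \<Rightarrow> nat \<Rightarrow> real"
    assume A: "X \<subseteq> Rn n" "bij_betw x {..<N} X" "0 \<in> convex hull X" "1 \<le> k"
    obtain t s where ts: "exec select_points (input_state n k N x) t s" "t \<le> c * (N + k + n) ^ d"
      using cd[OF A(4)] by blast
    have "card X = N" using bij_betw_same_card[OF A(2)] by simp
    then show "\<exists>t s. exec select_points (input_state n k N x) t s \<and>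
                     t \<le> c * (card X + k + n) ^ d \<and>
                     (\<forall>i<k. output_point n s i \<in> X) \<and>
                     (\<forall>K. K \<subseteq> Rn n \<and> convex K \<and> X \<subseteq> K \<longrightarrow>
                        gauge_norm K ((1 / real k) *\<^sub>R (\<Sum>i<k. output_point n s i))
                          \<le> ereal (real (min_card X n) / real k))"
      using ts select_points_output[OF A ts(1)] by blast
  qed
qed

end
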